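(* Let $\psi\in C_c^\infty(\mathbb{R}^3)$ and for $\lambda>0$ define the oscillatory integral operator \[ \mathcal{O}_\lambda f(x,y)=\int_{\mathbb{R}} e^{i\lambda\,(x t^2+y^2 t)}\,\psi(x,y,t)\,f(t)\,dt,\qquad (x,y)\in\mathbb{R}^2, \] for $f\in L^2(\mathbb{R})$. Then there is a constant $C_\psi$ depending only on $\psi$ such that for all $\lambda>0$ and all $f\in L^2(\mathbb{R})$, \[ \|\mathcal{O}_\lambda f\|_{L^2(\mathbb{R}^2)}\le C_\psi\,\lambda^{-3/8}\,\|f\|_{L^2(\mathbb{R})} \quad\text{and}\quad \|\mathcal{O}_\lambda f\|_{L^6(\mathbb{R}^2)}\le C_\psi\,\lambda^{-1/4}\,\|f\|_{L^2(\mathbb{R})}. \] Moreover, the second estimate is sharp: if $\delta\in\mathbb{R}$ is such that for every $\psi\in C_c^\infty(\mathbb{R}^3)$ there is a constant $C_\psi$ with $\|\mathcal{O}_\lambda f\|_{L^6(\mathbb{R}^2)}\le C_\psi\lambda^{-\delta}\|f\|_{L^2(\mathbb{R})}$ for all $f\in L^2(\mathbb{R})$ and all sufficiently large $\lambda$, then $\delta\le 1/4$.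
   Context: $\psi$ is a smooth compactly supported cut-off function on $\mathbb{R}^3$ in the variables $(x,y,t)$. *)

theory Defs
  imports "HOL-Analysis.Analysis"
begin

text \<open>C-infinity: differentiable everywhere, and every directional (Frechet) derivative
  is again C-infinity (coinductively, i.e. derivatives of all orders exist).\<close>
coinductive smooth :: "('a::real_normed_vector \<Rightarrow> 'b::real_normed_vector) \<Rightarrow> bool" where
  "(\<forall>x. f differentiable (at x)) \<Longrightarrow> (\<forall>v. smooth (\<lambda>x. frechet_derivative f (at x) v))
   \<Longrightarrow> smooth f"

definition compact_support :: "('a::topological_space \<Rightarrow> 'b::zero) \<Rightarrow> bool" where
  "compact_support f \<longleftrightarrow> compact (closure {x. f x \<noteq> 0})"

definition Cc_inf :: "('a::real_normed_vector \<Rightarrow> 'b::real_normed_vector) \<Rightarrow> bool" where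
  "Cc_inf f \<longleftrightarrow> smooth f \<and> compact_support f"

definition in_Lp :: "real \<Rightarrow> 'a measure \<Rightarrow> ('a \<Rightarrow> 'b::{banach,second_countable_topology}) \<Rightarrow> bool" where
  "in_Lp p M g \<longleftrightarrow> g \<in> borel_measurable M \<and> integrable M (\<lambda>x. norm (g x) powr p)"

definition Lp_norm :: "real \<Rightarrow> 'a measure \<Rightarrow> ('a \<Rightarrow> 'b::real_normed_vector) \<Rightarrow> real" where
  "Lp_norm p M g = (LINT x|M. norm (g x) powr p) powr (1 / p)"

definition osc_op :: "(real \<times> real \<times> real \<Rightarrow> complex) \<Rightarrow> real \<Rightarrow> (real \<Rightarrow> complex)
    \<Rightarrow> real \<times> real \<Rightarrow> complex" where
  "osc_op \<psi> lam f = (\<lambda>(x, y). LINT t|lborel.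
      exp (\<i> * complex_of_real (lam * (x * t\<^sup>2 + y\<^sup>2 * t))) * \<psi> (x, y, t) * f t)"

end

theory Submission
  imports Defs "HOL-Probability.Probability" "HOL-Real_Asymp.Real_Asymp"
begin

text \<open>
  Cubing turns the \<open>L\<^sup>6\<close> bound into an \<open>L\<^sup>2\<close> bound: the third power of the operator
  is an oscillatory integral over three variables \<open>t\<^sub>1, t\<^sub>2, t\<^sub>3\<close> whose phase pairs
  \<open>(x, y\<^sup>2)\<close> with \<open>(\<Sum> t\<^sub>i\<^sup>2, \<Sum> t\<^sub>i)\<close>.  Writing \<open>\<psi>\<close> as a superposition of
  indicators of quadrants with weight \<open>\<psi>\<^sub>x\<^sub>y\<close> and absorbing this weight into \<open>f\<close> leaves an
  operator without amplitude; majorizing the cut-off in \<open>x\<close> by a Gaussian and keeping a sharp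
  interval in \<open>y\<close>, the \<open>T\<^sup>*T\<close> kernel is \<open>exp (-(\<lambda>P)\<^sup>2/2)\<close> times a Fresnel integral of size
  \<open>1/\<surd>(\<lambda>\<bar>Q\<bar>)\<close>, where \<open>P\<close> and \<open>Q\<close> are the differences of \<open>\<Sum> t\<^sub>i\<^sup>2\<close> and \<open>\<Sum> t\<^sub>i\<close>.
  In one variable \<open>P = (t - s)(t + s)\<close>, and Schur's test gives \<open>\<lambda> powr (-3/4)\<close>; in three variables
  planes cut spheres in circles, so Lebesgue measure has bounded density in \<open>(P, Q)\<close> and
  Schur's test gives \<open>\<lambda> powr (-3/2)\<close>.  For the sharpness, with \<open>f\<close> the indicator of an interval
  there is no cancellation on the rectangle \<open>\<bar>x\<bar> \<le> 1/\<lambda>\<close>, \<open>\<bar>y\<bar> \<le> 1/\<surd>\<lambda>\<close>.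
\<close>

section \<open>Schur test for oscillatory integrals\<close>

text \<open>The final exponents are roots of the Schur bounds: 3/8 is half of 3/4, and 1/4 is one
  sixth of 3/2. Three variables are taken because fixing the sum of two leaves a single free
  variable, in which the sum of squares has a critical point and the density an inverse square root
  singularity; on a plane the region where P is at most 1/lam in size has area O(1/lam), uniformly.
  The amplitude depends on (x, y), so it would enter the kernel and destroy its explicit form. In
  the quadrant representation (x, y) occurs only in indicators, which leave the t integral and have
  modulus at most 1. A majorant in x is harmless because only the nonnegative square of the modulus
  is integrated; the phase is linear in x, so a Gaussian weight gives an explicit kernel decaying in
  P. In y the phase is stationary at 0, which limits the decay to the inverse square root of Q, and
  a sharp cut-off already reaches this rate. The singularity in Q is integrable only locally; in
  three variables this is where the bounded support in t enters.\<close>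

lemma borel_measurable_cnj [measurable (raw)]:
  assumes "f \<in> borel_measurable M"
  shows "(\<lambda>x. cnj (f x)) \<in> borel_measurable M"
  by (rule borel_measurable_continuous_on[OF _ assms]) (intro continuous_intros)

text \<open>Expanding the square modulus and integrating in \<open>w\<close> first produces the
  kernel of T*T. Since this kernel is Hermitian, bounding its rows also bounds its columns, so a
  single hypothesis \<open>schur\<close> suffices. Integrability of \<open>G\<close> and finiteness
  of \<open>W\<close> justify Fubini; the set \<open>A\<close> lets the row integrals see only the
  support of \<open>G\<close>.\<close>

lemma TTstar_schur:
  fixes e :: "'w \<Rightarrow> 'm \<Rightarrow> complex" and G :: "'m \<Rightarrow> complex"
  assumes "finite_measure W" "sigma_finite_measure M"
    and e [measurable]: "(\<lambda>(w,m). e w m) \<in> borel_measurable (W \<Otimes>\<^sub>M M)"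
    and e1: "\<And>w m. norm (e w m) \<le> 1"
    and G: "integrable M G"
    and A [measurable]: "A \<in> sets M" and supp: "\<And>m. m \<notin> A \<Longrightarrow> G m = 0"
    and schur: "\<And>m. m \<in> A \<Longrightarrow>
      (\<integral>\<^sup>+m'. ennreal (norm (LINT w|W. e w m * cnj (e w m'))) * indicator A m' \<partial>M) \<le> S"
  shows "(\<integral>\<^sup>+w. ennreal ((norm (LINT m|M. e w m * G m))\<^sup>2) \<partial>W)
           \<le> S * (\<integral>\<^sup>+m. ennreal ((norm (G m))\<^sup>2) \<partial>M)"
proof -
  interpret W: finite_measure W by fact
  interpret M: sigma_finite_measure M by fact
  interpret MM: pair_sigma_finite M M ..
  interpret N: sigma_finite_measure "M \<Otimes>\<^sub>M M" by (rule MM.P.sigma_finite_measure_axioms)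
  interpret WN: pair_sigma_finite W "M \<Otimes>\<^sub>M M" ..
  have [measurable]: "G \<in> borel_measurable M" using G by simp
  define E where "E w = (LINT m|M. e w m * G m)" for w
  define K where "K m m' = (LINT w|W. e w m * cnj (e w m'))" for m m'
  define H where "H = (\<lambda>(w,n). (e w (fst n) * G (fst n)) * cnj (e w (snd n) * G (snd n)))"
  have [measurable]: "(\<lambda>m. e w m) \<in> borel_measurable M" if "w \<in> space W" for w
    using measurable_Pair2[OF e that] by simp
  have [measurable]: "(\<lambda>w. E w) \<in> borel_measurable W" unfolding E_def by measurable
  have Hm [measurable]: "H \<in> borel_measurable (W \<Otimes>\<^sub>M (M \<Otimes>\<^sub>M M))"
    unfolding H_def by measurable
  have Km [measurable]: "(\<lambda>(m,m'). K m m') \<in> borel_measurable (M \<Otimes>\<^sub>M M)"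
    unfolding K_def by measurable
  \<comment> \<open>Hermitian symmetry is what later makes the two halves of the
    arithmetic-geometric mean bound equal.\<close>
  have K_sym: "norm (K m m') = norm (K m' m)" for m m'
  proof -
    have "K m m' = cnj (K m' m)"
      unfolding K_def using Bochner_Integration.integral_cnj[of W "\<lambda>w. e w m' * cnj (e w m)"] by (simp add: mult.commute)
    then show ?thesis by simp
  qed
  have ennreal_add_half: "x / 2 + x / 2 = x" for x :: ennreal
  proof -
    have "x / 2 + x / 2 = x * 2 / 2"
      by (simp only: mult_2[symmetric] ennreal_times_divide mult.commute)
    also have "\<dots> = x" by (rule mult_divide_eq_ennreal) auto
    finally show ?thesis .
  qed
  have nG: "(\<integral>\<^sup>+m. ennreal (norm (G m)) \<partial>M) < \<infinity>"
    using G by (simp add: integrable_iff_bounded)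
  have GGint: "integrable (M \<Otimes>\<^sub>M M) (\<lambda>n. norm (G (fst n)) * norm (G (snd n)))"
  proof (rule integrableI_bounded)
    have "(\<integral>\<^sup>+n. ennreal (norm (norm (G (fst n)) * norm (G (snd n)))) \<partial>(M \<Otimes>\<^sub>M M))
       = (\<integral>\<^sup>+m. \<integral>\<^sup>+m'. ennreal (norm (G m)) * ennreal (norm (G m')) \<partial>M \<partial>M)"
      by (subst M.nn_integral_fst[symmetric]) (auto simp: ennreal_mult)
    also have "\<dots> = (\<integral>\<^sup>+m. ennreal (norm (G m)) \<partial>M) * (\<integral>\<^sup>+m. ennreal (norm (G m)) \<partial>M)"
      by (simp add: nn_integral_cmult nn_integral_multc)
    also have "\<dots> < \<infinity>" using nG by (simp add: ennreal_mult_less_top)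
    finally show "(\<integral>\<^sup>+n. ennreal (norm (norm (G (fst n)) * norm (G (snd n)))) \<partial>(M \<Otimes>\<^sub>M M)) < \<infinity>" .
  qed simp
  have Hb: "norm (H (w,n)) \<le> norm (G (fst n)) * norm (G (snd n))" for w n
  proof -
    have "norm (H (w,n)) = (norm (e w (fst n)) * norm (G (fst n))) * (norm (e w (snd n)) * norm (G (snd n)))"
      by (simp add: H_def norm_mult)
    also have "\<dots> \<le> (1 * norm (G (fst n))) * (1 * norm (G (snd n)))"
      by (intro mult_mono e1 mult_nonneg_nonneg) auto
    finally show ?thesis by simp
  qed
  have Hint: "integrable (W \<Otimes>\<^sub>M (M \<Otimes>\<^sub>M M)) H"
  proof (rule Bochner_Integration.integrable_bound)
    show "integrable (W \<Otimes>\<^sub>M (M \<Otimes>\<^sub>M M)) (\<lambda>p. norm (G (fst (snd p))) * norm (G (snd (snd p))))"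
    proof (rule integrableI_bounded)
      have "(\<integral>\<^sup>+p. ennreal (norm (norm (G (fst (snd p))) * norm (G (snd (snd p))))) \<partial>(W \<Otimes>\<^sub>M (M \<Otimes>\<^sub>M M)))
        = (\<integral>\<^sup>+w. \<integral>\<^sup>+n. ennreal (norm (G (fst n)) * norm (G (snd n))) \<partial>(M \<Otimes>\<^sub>M M) \<partial>W)"
        by (subst MM.P.nn_integral_fst[symmetric]) auto
      also have "\<dots> = (\<integral>\<^sup>+n. ennreal (norm (G (fst n)) * norm (G (snd n))) \<partial>(M \<Otimes>\<^sub>M M)) * emeasure W (space W)"
        by simp
      also have "\<dots> < \<infinity>"
        using GGint W.emeasure_finite[of "space W"]
        by (simp add: integrable_iff_bounded less_top[symmetric] ennreal_mult_eq_top_iff)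
      finally show "(\<integral>\<^sup>+p. ennreal (norm (norm (G (fst (snd p))) * norm (G (snd (snd p))))) \<partial>(W \<Otimes>\<^sub>M (M \<Otimes>\<^sub>M M))) < \<infinity>" .
    qed simp
    show "AE p in W \<Otimes>\<^sub>M (M \<Otimes>\<^sub>M M). norm (H p) \<le> norm (norm (G (fst (snd p))) * norm (G (snd (snd p))))"
      using Hb by (auto intro!: AE_I2)
  qed simp
  have eGint: "integrable M (\<lambda>m. e w m * G m)" if "w \<in> space W" for w
    by (rule Bochner_Integration.integrable_bound[OF G])
       (use that e1[of w] in \<open>auto simp: norm_mult mult_left_le_one_le\<close>)
  have EE: "E w * cnj (E w) = (LINT n|(M \<Otimes>\<^sub>M M). H (w,n))" if w: "w \<in> space W" for w
  proof -
    have i: "integrable (M \<Otimes>\<^sub>M M) (\<lambda>n. H (w,n))"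
      by (rule Bochner_Integration.integrable_bound[OF GGint]) (use w Hb in \<open>auto intro!: AE_I2\<close>)
    have "(LINT n|(M \<Otimes>\<^sub>M M). H (w,n)) = (LINT m|M. LINT m'|M. H (w,(m,m')))"
      using MM.integral_fst'[OF i] by simp
    also have "\<dots> = (LINT m|M. (e w m * G m) * cnj (E w))"
      unfolding H_def E_def by (simp del: complex_cnj_mult)
    also have "\<dots> = E w * cnj (E w)" by (simp add: E_def)
    finally show ?thesis by simp
  qed
  \<comment> \<open>The squared norm is treated as a complex Bochner integral, so that Fubini
    applies to \<open>H\<close> before any absolute value is taken and the cancellation in
    \<open>w\<close> is kept.\<close>
  have "ennreal (norm (LINT w|W. complex_of_real ((norm (E w))\<^sup>2))) =
        ennreal (norm (LINT w|W. (LINT n|(M \<Otimes>\<^sub>M M). H (w,n))))"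
    by (intro arg_cong[where f="\<lambda>z. ennreal (norm z)"] Bochner_Integration.integral_cong)
       (auto simp: EE[symmetric] complex_norm_square simp del: of_real_power)
  also have "(LINT w|W. (LINT n|(M \<Otimes>\<^sub>M M). H (w,n))) = (LINT n|(M \<Otimes>\<^sub>M M). (LINT w|W. H (w,n)))"
    using WN.Fubini_integral[of "\<lambda>w n. H (w,n)"] Hint by simp
  also have "\<dots> = (LINT n|(M \<Otimes>\<^sub>M M). K (fst n) (snd n) * (G (fst n) * cnj (G (snd n))))"
  proof (intro Bochner_Integration.integral_cong refl)
    fix n
    have "(LINT w|W. H (w,n)) = (LINT w|W. (e w (fst n) * cnj (e w (snd n))) * (G (fst n) * cnj (G (snd n))))"
      by (intro Bochner_Integration.integral_cong refl) (simp add: H_def)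
    then show "(LINT w|W. H (w,n)) = K (fst n) (snd n) * (G (fst n) * cnj (G (snd n)))"
      by (simp add: K_def)
  qed
  also have "ennreal (norm \<dots>) \<le> (\<integral>\<^sup>+n. ennreal (norm (K (fst n) (snd n) * (G (fst n) * cnj (G (snd n))))) \<partial>(M \<Otimes>\<^sub>M M))"
    by (rule integral_norm_bound_ennreal)
       (use WN.integrable_snd[of "\<lambda>w n. H (w,n)"] Hint in \<open>auto simp: H_def K_def mult_ac\<close>)
  \<comment> \<open>The product of the two values of \<open>G\<close> is at most half the sum of
    their squares. In each half the indicator of \<open>A\<close> stays on the variable whose factor
    of \<open>G\<close> disappears, so the row integrals remain restricted to
    \<open>A\<close>.\<close>
  also have "\<dots> \<le> (\<integral>\<^sup>+n. (ennreal (norm (K (fst n) (snd n))) * indicator A (snd n) * ennreal ((norm (G (fst n)))\<^sup>2) / 2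
       + ennreal (norm (K (fst n) (snd n))) * indicator A (fst n) * ennreal ((norm (G (snd n)))\<^sup>2) / 2) \<partial>(M \<Otimes>\<^sub>M M))"
  proof (intro nn_integral_mono)
    fix n
    let ?k = "norm (K (fst n) (snd n))" and ?a = "norm (G (fst n))" and ?b = "norm (G (snd n))"
    show "ennreal (norm (K (fst n) (snd n) * (G (fst n) * cnj (G (snd n))))) \<le>
        ennreal ?k * indicator A (snd n) * ennreal (?a\<^sup>2) / 2 + ennreal ?k * indicator A (fst n) * ennreal (?b\<^sup>2) / 2"
    proof (cases "fst n \<in> A \<and> snd n \<in> A")
      case True
      have "?a * ?b \<le> ?a\<^sup>2 / 2 + ?b\<^sup>2 / 2"
        using sum_squares_bound[of ?a ?b] by simp
      then have "?k * (?a * ?b) \<le> ?k * (?a\<^sup>2 / 2 + ?b\<^sup>2 / 2)"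
        by (rule mult_left_mono) simp
      then have "ennreal (?k * (?a * ?b)) \<le> ennreal (?k * ?a\<^sup>2 / 2 + ?k * ?b\<^sup>2 / 2)"
        by (intro ennreal_leI) (simp add: algebra_simps)
      also have "\<dots> = ennreal ?k * ennreal (?a\<^sup>2) / 2 + ennreal ?k * ennreal (?b\<^sup>2) / 2"
        by (simp add: ennreal_mult divide_ennreal[symmetric])
      finally show ?thesis using True by (simp add: norm_mult)
    next
      case False
      then show ?thesis using supp by (auto simp: norm_mult)
    qed
  qed
  also have "\<dots> = (\<integral>\<^sup>+n. ennreal (norm (K (fst n) (snd n))) * indicator A (snd n) * ennreal ((norm (G (fst n)))\<^sup>2) / 2 \<partial>(M \<Otimes>\<^sub>M M))
      + (\<integral>\<^sup>+n. ennreal (norm (K (fst n) (snd n))) * indicator A (fst n) * ennreal ((norm (G (snd n)))\<^sup>2) / 2 \<partial>(M \<Otimes>\<^sub>M M))"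
    (is "_ = ?I1 + ?I2")
    by (intro nn_integral_add) auto
  also have "?I2 = (\<integral>\<^sup>+m'. (\<integral>\<^sup>+m. ennreal (norm (K m m')) * indicator A m * ennreal ((norm (G m'))\<^sup>2) / 2 \<partial>M) \<partial>M)"
    by (subst MM.nn_integral_snd[symmetric]) auto
  also have "\<dots> = ?I1"
    by (subst M.nn_integral_fst[symmetric]) (auto simp: K_sym)
  also have "?I1 + ?I1 = (\<integral>\<^sup>+n. ennreal (norm (K (fst n) (snd n))) * indicator A (snd n) * ennreal ((norm (G (fst n)))\<^sup>2) \<partial>(M \<Otimes>\<^sub>M M))"
    by (subst nn_integral_add[symmetric]) (auto simp: ennreal_add_half)
  also have "\<dots> = (\<integral>\<^sup>+m. (\<integral>\<^sup>+m'. ennreal (norm (K m m')) * indicator A m' * ennreal ((norm (G m))\<^sup>2) \<partial>M) \<partial>M)"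
    by (subst M.nn_integral_fst[symmetric]) auto
  also have "\<dots> = (\<integral>\<^sup>+m. (\<integral>\<^sup>+m'. ennreal (norm (K m m')) * indicator A m' \<partial>M) * ennreal ((norm (G m))\<^sup>2) \<partial>M)"
    by (intro nn_integral_cong nn_integral_multc) auto
  also have "\<dots> \<le> (\<integral>\<^sup>+m. S * ennreal ((norm (G m))\<^sup>2) \<partial>M)"
  proof (intro nn_integral_mono)
    fix m
    show "(\<integral>\<^sup>+m'. ennreal (norm (K m m')) * indicator A m' \<partial>M) * ennreal ((norm (G m))\<^sup>2) \<le> S * ennreal ((norm (G m))\<^sup>2)"
      using schur[of m] supp[of m] by (cases "m \<in> A") (auto simp: K_def intro: mult_right_mono)
  qed
  also have "\<dots> = S * (\<integral>\<^sup>+m. ennreal ((norm (G m))\<^sup>2) \<partial>M)"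
    by (intro nn_integral_cmult) auto
  finally have *: "ennreal (norm (LINT w|W. complex_of_real ((norm (E w))\<^sup>2))) \<le> S * (\<integral>\<^sup>+m. ennreal ((norm (G m))\<^sup>2) \<partial>M)" .
  \<comment> \<open>Boundedness of \<open>E\<close> on the finite measure \<open>W\<close> makes its
    square integrable; otherwise the Bochner integral bounded above could be the default value
    0.\<close>
  have Eb: "norm (E w) \<le> (LINT m|M. norm (G m))" for w
  proof (cases "integrable M (\<lambda>m. e w m * G m)")
    case True
    have "norm (E w) \<le> (LINT m|M. norm (e w m * G m))"
      unfolding E_def by (rule integral_norm_bound)
    also have "\<dots> \<le> (LINT m|M. norm (G m))"
      using integrable_norm[OF True] G e1 by (intro integral_mono) (auto simp: norm_mult mult_left_le_one_le)
    finally show ?thesis .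
  qed (simp add: E_def not_integrable_integral_eq)
  have Esq: "integrable W (\<lambda>w. (norm (E w))\<^sup>2)"
    by (rule W.integrable_const_bound[where B="(LINT m|M. norm (G m))\<^sup>2"]) (use Eb in \<open>auto intro!: power_mono\<close>)
  have "(\<integral>\<^sup>+w. ennreal ((norm (E w))\<^sup>2) \<partial>W) = ennreal (norm (LINT w|W. complex_of_real ((norm (E w))\<^sup>2)))"
    using Esq by (subst nn_integral_eq_integral) (auto simp del: of_real_power)
  then show ?thesis using * by (simp add: E_def)
qed

section \<open>One-dimensional integrals\<close>

text \<open>Rescaling \<open>y\<close> by the square root of the frequency predicts the size. The
  point is uniformity in \<open>R\<close>, which is what permits a sharp cut-off; for negative
  \<open>R\<close> the interval is empty.\<close>

lemma norm_integral_cis_quadratic_le: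
  assumes "\<mu> \<noteq> 0"
  shows "norm (LINT y:{-R..R}|lborel. cis (\<mu> * y\<^sup>2)) \<le> (1 + 4 * pi) / sqrt \<bar>\<mu>\<bar>"
proof (cases "R \<ge> 0")
  case R: True
  \<comment> \<open>With this scale the norm of \<open>z y - 1\<close> is \<open>(b * y)^2\<close>
    and the squared norm of \<open>z y\<close> is \<open>1 + (b * y)^4\<close>.\<close>
  define b where "b = sqrt (2 * \<bar>\<mu>\<bar>)"
  have b: "b > 0" "b\<^sup>2 = 2 * \<bar>\<mu>\<bar>" using assms by (auto simp: b_def)
  \<comment> \<open>The derivative of \<open>y\<close> times the oscillating factor is exactly
    \<open>z y\<close> times that factor. Dividing by \<open>z\<close>, which never vanishes, leaves
    only the derivative of \<open>1 / z\<close> as error.\<close>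
  define z :: "real \<Rightarrow> complex" where "z y = 1 + 2 * \<i> * of_real (\<mu> * y\<^sup>2)" for y
  have z0: "z y \<noteq> 0" for y by (auto simp: z_def complex_eq_iff)
  have nz: "(norm (z y))\<^sup>2 = 1 + (b * y)^4" for y
  proof -
    have "(norm (z y))\<^sup>2 = 1 + (2 * \<mu> * y\<^sup>2)\<^sup>2" by (simp add: z_def cmod_power2 mult.assoc)
    also have "(2 * \<mu> * y\<^sup>2)\<^sup>2 = (b\<^sup>2)\<^sup>2 * y^4" by (simp add: b power_mult_distrib)
    finally show ?thesis by (simp add: power_mult_distrib)
  qed
  txt \<open>\<open>F\<close> is a primitive up to the error \<open>\<rho>\<close>, whose \<open>L\<^sup>1\<close> norm already has the right size;
    unlike the usual integration by parts it has no singularity at the stationary point.\<close>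
  define F where "F y = cis (\<mu> * y\<^sup>2) * of_real y / z y" for y
  define \<rho> where "\<rho> y = cis (\<mu> * y\<^sup>2) * (2 * (z y - 1) / (z y)\<^sup>2)" for y
  have dz: "(z has_vector_derivative (4 * \<i> * of_real (\<mu> * y))) (at y within S)" for y S
    unfolding z_def by (auto intro!: derivative_eq_intros simp: power2_eq_square)
  have dc: "((\<lambda>y. cis (\<mu> * y\<^sup>2)) has_vector_derivative (2 * \<i> * of_real (\<mu> * y) * cis (\<mu> * y\<^sup>2))) (at y within S)" for y S
  proof -
    have "((\<lambda>y. \<i> * complex_of_real (\<mu> * y\<^sup>2)) has_vector_derivative (2 * \<i> * of_real (\<mu> * y))) (at y within S)"
      by (auto intro!: derivative_eq_intros simp: power2_eq_square)
    from field_vector_diff_chain_within[OF this DERIV_subset[OF DERIV_exp subset_UNIV]]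
    show ?thesis by (simp add: o_def cis_conv_exp)
  qed
  have dF: "(F has_vector_derivative (cis (\<mu> * y\<^sup>2) - \<rho> y)) (at y within S)" for y S
  proof -
    have di: "((\<lambda>y. inverse (z y)) has_vector_derivative (4 * \<i> * of_real (\<mu> * y) * - ((inverse (z y))\<^sup>2))) (at y within S)"
      using field_vector_diff_chain_within[OF dz[of y S] DERIV_subset[OF DERIV_inverse[OF z0] subset_UNIV]]
      by (simp add: o_def numeral_2_eq_2)
    have dy: "(complex_of_real has_vector_derivative 1) (at y within S)"
      using has_vector_derivative_of_real[of "\<lambda>x. x" 1] by auto
    note d = has_vector_derivative_mult[OF has_vector_derivative_mult[OF dc[of y S] dy] di]
    have w: "2 * \<i> * complex_of_real (\<mu> * y) * of_real y = z y - 1"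
      by (simp add: z_def power2_eq_square)
    have "cis (\<mu> * y\<^sup>2) * complex_of_real y * (4 * \<i> * complex_of_real (\<mu> * y) * - (inverse (z y))\<^sup>2) +
        (cis (\<mu> * y\<^sup>2) * 1 + 2 * \<i> * complex_of_real (\<mu> * y) * cis (\<mu> * y\<^sup>2) * complex_of_real y) * inverse (z y)
      = cis (\<mu> * y\<^sup>2) * (- 2 * (2 * \<i> * complex_of_real (\<mu> * y) * of_real y) / (z y)\<^sup>2
         + (1 + 2 * \<i> * complex_of_real (\<mu> * y) * of_real y) / z y)"
      by (simp add: algebra_simps divide_inverse power_inverse)
    also have "\<dots> = cis (\<mu> * y\<^sup>2) - \<rho> y"
      unfolding w using z0[of y] by (simp add: \<rho>_def field_simps)
    finally show ?thesis using d by (simp add: F_def[abs_def] divide_inverse)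
  qed
  have cz: "continuous_on S z" for S unfolding z_def by (intro continuous_intros)
  have ccis: "continuous_on S (\<lambda>y. cis (\<mu> * y\<^sup>2))" for S unfolding cis_conv_exp by (intro continuous_intros)
  have crho: "continuous_on S \<rho>" for S
    unfolding \<rho>_def using z0 by (intro continuous_intros cz ccis) auto
  have I1: "((\<lambda>y. cis (\<mu> * y\<^sup>2) - \<rho> y) has_integral (F R - F (-R))) {-R..R}"
    using R dF by (intro fundamental_theorem_of_calculus) auto
  have I2: "\<rho> integrable_on {-R..R}" using crho integrable_continuous_interval by blast
  have "(LINT y:{-R..R}|lborel. cis (\<mu> * y\<^sup>2)) = integral {-R..R} (\<lambda>y. cis (\<mu> * y\<^sup>2))"
    by (intro set_borel_integral_eq_integral borel_integrable_atLeastAtMost')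
       (use ccis in auto)
  also have "\<dots> = integral {-R..R} (\<lambda>y. (cis (\<mu> * y\<^sup>2) - \<rho> y) + \<rho> y)" by simp
  also have "\<dots> = (F R - F (-R)) + integral {-R..R} \<rho>"
    using I1 I2 by (subst integral_add) (auto simp: integral_unique)
  finally have eq: "(LINT y:{-R..R}|lborel. cis (\<mu> * y\<^sup>2)) = (F R - F (-R)) + integral {-R..R} \<rho>" .
  \<comment> \<open>The denominator grows like \<open>y^2\<close> for large \<open>y\<close> and is
    at least 1 near 0; \<open>2 * v \<le> 1 + v^2\<close> with \<open>v = (b * y)^2\<close>
    interpolates between the two regimes.\<close>
  have nF: "norm (F y) \<le> 1 / (2 * sqrt \<bar>\<mu>\<bar>)" for y
  proof -
    have "(2 * sqrt \<bar>\<mu>\<bar> * \<bar>y\<bar>)\<^sup>2 = 2 * (b * y)\<^sup>2"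
      by (simp add: power_mult_distrib b)
    also have "\<dots> \<le> 1 + (b * y)^4"
      using sum_squares_bound[of 1 "(b*y)\<^sup>2"] by simp
    finally have "2 * sqrt \<bar>\<mu>\<bar> * \<bar>y\<bar> \<le> norm (z y)"
      unfolding nz[symmetric] by (rule power2_le_imp_le) simp
    then show ?thesis using assms z0[of y]
      by (simp add: F_def norm_mult norm_divide norm_power field_simps)
  qed
  have "norm (integral {-R..R} \<rho>) \<le> integral {-R..R} (\<lambda>y. 4 / (1 + (b * y)\<^sup>2))"
  proof (rule integral_norm_bound_integral[OF I2])
    show "(\<lambda>y. 4 / (1 + (b * y)\<^sup>2)) integrable_on {-R..R}"
      by (intro integrable_continuous_interval continuous_intros) (auto simp: add_nonneg_eq_0_iff)
    fix y
    have "norm (z y - 1) = (b * y)\<^sup>2"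
      by (simp add: z_def norm_mult norm_power abs_mult power_mult_distrib b)
    then have "norm (\<rho> y) = 2 * (b * y)\<^sup>2 / (1 + (b * y)^4)"
      by (simp add: \<rho>_def norm_mult norm_divide norm_power nz del: right_diff_distrib_numeral)
    \<comment> \<open>The error decays like the inverse square of \<open>b * y\<close>, so it can be
      compared with the derivative of an arctangent.\<close>
    also have "\<dots> \<le> 4 / (1 + (b * y)\<^sup>2)"
    proof -
      define v where "v = (b * y)\<^sup>2"
      have v: "v \<ge> 0" "(b * y)^4 = v\<^sup>2" by (auto simp: v_def)
      define x where "x = v\<^sup>2"
      have x: "0 \<le> x" "2 * v \<le> 1 + x" "v * v = x"
        using sum_squares_bound[of 1 v] by (auto simp: x_def power2_eq_square)
      have "2 * v * (1 + v) \<le> 4 * (1 + x)"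
        using x by (simp add: distrib_left mult.assoc)
      then have "2 * v * (1 + v) \<le> 4 * (1 + v\<^sup>2)" by (simp add: x_def)
      then show ?thesis unfolding v_def[symmetric] v(2) using v(1)
        by (simp add: frac_le_eq divide_simps add_pos_nonneg)
    qed
    finally show "norm (\<rho> y) \<le> 4 / (1 + (b * y)\<^sup>2)" .
  qed
  also have "((\<lambda>y. 4 / (1 + (b * y)\<^sup>2)) has_integral (4 / b * arctan (b * R) - 4 / b * arctan (b * (-R)))) {-R..R}"
  proof (rule fundamental_theorem_of_calculus)
    show "((\<lambda>y. 4 / b * arctan (b * y)) has_vector_derivative 4 / (1 + (b * y)\<^sup>2)) (at y within {-R..R})" for y
    proof -
      have "((\<lambda>y. arctan (b * y)) has_real_derivative (b / (1 + (b * y)\<^sup>2))) (at y within {-R..R})"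
        by (auto intro!: derivative_eq_intros simp: divide_inverse)
      from DERIV_cmult[OF this, of "4 / b"] show ?thesis
        unfolding has_real_derivative_iff_has_vector_derivative[symmetric] using b(1) by simp
    qed
  qed (use R in auto)
  then have "integral {-R..R} (\<lambda>y. 4 / (1 + (b * y)\<^sup>2)) = 4 / b * (2 * arctan (b * R))"
    by (simp add: integral_unique arctan_minus)
  also have "\<dots> \<le> 4 / b * pi"
    using b arctan_ubound[of "b * R"] by (intro mult_left_mono) auto
  also have "\<dots> \<le> 4 * pi / sqrt \<bar>\<mu>\<bar>"
    using assms by (auto simp: b_def real_sqrt_mult field_simps)
  finally have "norm (integral {-R..R} \<rho>) \<le> 4 * pi / sqrt \<bar>\<mu>\<bar>" .
  moreover have "norm (F R - F (-R)) \<le> 1 / sqrt \<bar>\<mu>\<bar>"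
    using norm_triangle_ineq4[of "F R" "F (-R)"] nF[of R] nF[of "-R"] by simp
  ultimately show ?thesis
    unfolding eq by (intro order_trans[OF norm_triangle_ineq]) (simp add: add_divide_distrib)
qed (use assms in \<open>simp add: set_lebesgue_integral_def add_nonneg_nonneg\<close>)

text \<open>The substitution \<open>u = v^2 / c\<close> turns the integrand into the derivative of
  an arctangent. It is applied with \<open>c = sqrt lam\<close>, where the value
  \<open>pi * lam powr (-1/4)\<close> supplies the gain beyond the Fresnel factor in the
  one-variable Schur bound.\<close>

lemma nn_integral_inv_sqrt_times_inv_linear:
  assumes "c > 0"
  shows "(\<integral>\<^sup>+u. ennreal (1 / (sqrt u * (1 + c * u)) * indicator {0<..} u) \<partial>lborel) = ennreal (pi / sqrt c)"
proof -
  let ?F = "\<lambda>u. 2 / sqrt c * arctan (sqrt (c * u))"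
  let ?f = "\<lambda>u. 1 / (sqrt u * (1 + c * u))"
  have D: "DERIV ?F u :> ?f u" if "u > 0" for u
  proof -
    have "((\<lambda>u. arctan (sqrt (c * u))) has_real_derivative (sqrt c / (2 * sqrt u * (1 + c * u)))) (at u)"
      using that assms
      by (auto intro!: derivative_eq_intros simp: real_sqrt_mult field_simps)
    from DERIV_cmult[OF this, of "2 / sqrt c"] show ?thesis using assms by simp
  qed
  have nn: "AE x in lborel. ereal 0 < ereal x \<longrightarrow> ereal x < \<infinity> \<longrightarrow> 0 \<le> ?f x"
    using assms by auto
  have "((?F \<circ> real_of_ereal) \<longlongrightarrow> 0) (at_right (ereal 0))"
    unfolding ereal_tendsto_simps
    using assms by (auto intro!: tendsto_eq_intros)
  moreover have "((?F \<circ> real_of_ereal) \<longlongrightarrow> 2 / sqrt c * (pi / 2)) (at_left \<infinity>)"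
    unfolding ereal_tendsto_simps using assms
    by (intro tendsto_intros filterlim_compose[OF tendsto_arctan_at_top]) real_asymp
  ultimately have I: "set_integrable lborel (einterval (ereal 0) \<infinity>) ?f" "(LBINT x=ereal 0..\<infinity>. ?f x) = 2 / sqrt c * (pi / 2) - 0"
    using D assms nn
    by (intro interval_integral_FTC_nonneg[where F="?F"]; auto intro!: continuous_intros simp: add_nonneg_eq_0_iff)+
  have ei: "einterval (ereal 0) \<infinity> = {0<..}" by (auto simp: einterval_def)
  have "(\<integral>\<^sup>+u. ennreal (?f u * indicator {0<..} u) \<partial>lborel) = ennreal (LINT u|lborel. ?f u * indicator {0<..} u)"
    using I(1) assms unfolding ei set_integrable_def
    by (intro nn_integral_eq_integral) (auto simp: mult.commute indicator_def)
  also have "(LINT u|lborel. ?f u * indicator {0<..} u) = pi / sqrt c"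
    using I(2) by (simp add: interval_lebesgue_integral_def ei set_lebesgue_integral_def mult.commute)
  finally show ?thesis .
qed

lemma nn_integral_inv_sqrt:
  assumes "a > 0"
  shows "(\<integral>\<^sup>+u. ennreal (1 / sqrt u * indicator {0<..<a} u) \<partial>lborel) = ennreal (2 * sqrt a)"
proof -
  let ?F = "\<lambda>u. 2 * sqrt u"
  let ?f = "\<lambda>u. 1 / sqrt u"
  have D: "DERIV ?F u :> ?f u" if "u > 0" for u
    using that by (auto intro!: derivative_eq_intros simp: field_simps)
  have nn: "AE x in lborel. ereal 0 < ereal x \<longrightarrow> ereal x < ereal a \<longrightarrow> 0 \<le> ?f x"
    by auto
  have "((?F \<circ> real_of_ereal) \<longlongrightarrow> 0) (at_right (ereal 0))"
    unfolding ereal_tendsto_simps by (auto intro!: tendsto_eq_intros)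
  moreover have "((?F \<circ> real_of_ereal) \<longlongrightarrow> 2 * sqrt a) (at_left (ereal a))"
    unfolding ereal_tendsto_simps by (auto intro!: tendsto_eq_intros)
  ultimately have I: "set_integrable lborel (einterval (ereal 0) (ereal a)) ?f" "(LBINT x=ereal 0..ereal a. ?f x) = 2 * sqrt a - 0"
    using D assms nn
    by (intro interval_integral_FTC_nonneg[where F="?F"]; auto intro!: continuous_intros)+
  have ei: "einterval (ereal 0) (ereal a) = {0<..<a}" by (auto simp: einterval_def)
  have "(\<integral>\<^sup>+u. ennreal (?f u * indicator {0<..<a} u) \<partial>lborel) = ennreal (LINT u|lborel. ?f u * indicator {0<..<a} u)"
    using I(1) assms unfolding ei set_integrable_def
    by (intro nn_integral_eq_integral) (auto simp: mult.commute indicator_def)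
  also have "(LINT u|lborel. ?f u * indicator {0<..<a} u) = 2 * sqrt a"
    using I(2) assms by (simp add: interval_lebesgue_integral_def ei set_lebesgue_integral_def mult.commute)
  finally show ?thesis .
qed

lemma nn_integral_even:
  fixes f :: "real \<Rightarrow> ennreal"
  assumes [measurable]: "f \<in> borel_measurable borel"
  shows "(\<integral>\<^sup>+u. f \<bar>u\<bar> \<partial>lborel) = 2 * (\<integral>\<^sup>+u. f u * indicator {0<..} u \<partial>lborel)"
proof -
  have "(\<integral>\<^sup>+u. f \<bar>u\<bar> \<partial>lborel) =
      (\<integral>\<^sup>+u. (f u * indicator {0<..} u + f (-u) * indicator {0<..} (-u)) \<partial>lborel)"
    by (intro nn_integral_cong_AE) (use AE_lborel_singleton[of 0] in \<open>auto split: split_indicator\<close>)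
  also have "\<dots> = (\<integral>\<^sup>+u. f u * indicator {0<..} u \<partial>lborel) + (\<integral>\<^sup>+u. f (-u) * indicator {0<..} (-u) \<partial>lborel)"
    by (intro nn_integral_add) auto
  also have "(\<integral>\<^sup>+u. f (-u) * indicator {0<..} (-u) \<partial>lborel) = (\<integral>\<^sup>+u. f u * indicator {0<..} u \<partial>lborel)"
    by (subst (2) nn_integral_real_affine[where c="-1" and t=0]) (auto simp: indicator_def)
  finally show ?thesis by (simp add: mult_2)
qed

lemma nn_integral_translate:
  fixes f :: "real \<Rightarrow> ennreal"
  assumes "f \<in> borel_measurable borel"
  shows "(\<integral>\<^sup>+u. f (t + u) \<partial>lborel) = (\<integral>\<^sup>+u. f u \<partial>lborel)"
  using nn_integral_real_affine[OF assms, of 1 t] by simp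

lemma nn_integral_reflect:
  fixes f :: "real \<Rightarrow> ennreal"
  assumes "f \<in> borel_measurable borel"
  shows "(\<integral>\<^sup>+u. f (t - u) \<partial>lborel) = (\<integral>\<^sup>+u. f u \<partial>lborel)"
  using nn_integral_real_affine[OF assms, of "-1" t] by simp

lemma two_times_ennreal: "2 * ennreal x = ennreal (2 * x)"
  using ennreal_mult'[of 2 x] by simp

lemma nn_integral_inv_one_plus_square:
  "(\<integral>\<^sup>+w. ennreal (1 / (1 + w\<^sup>2)) \<partial>lborel) = ennreal pi"
proof -
  have "(\<integral>\<^sup>+w. ennreal (1 / (1 + w\<^sup>2)) * indicator {0..} w \<partial>lborel) = ennreal (pi / 2 - arctan 0)"
  proof (rule nn_integral_FTC_atLeast)
    show "DERIV arctan w :> 1 / (1 + w\<^sup>2)" for w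
      using DERIV_arctan[of w] by (simp add: inverse_eq_divide)
  qed (use tendsto_arctan_at_top in auto)
  moreover have "(\<integral>\<^sup>+w. ennreal (1 / (1 + w\<^sup>2)) * indicator {0<..} w \<partial>lborel) = (\<integral>\<^sup>+w. ennreal (1 / (1 + w\<^sup>2)) * indicator {0..} w \<partial>lborel)"
    by (intro nn_integral_cong_AE) (use AE_lborel_singleton[of 0] in \<open>auto split: split_indicator\<close>)
  ultimately show ?thesis
    using nn_integral_even[of "\<lambda>w. ennreal (1 / (1 + w\<^sup>2))"] by (simp add: two_times_ennreal)
qed

text \<open>Substituting \<open>u = v w\<close> turns the area element into \<open>v\<close> times a
  one-dimensional integral in each variable, which avoids polar coordinates.\<close>
lemma nn_integral_inv_one_plus_square_ellipse_le:
  assumes "lam > (0::real)"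
  shows "(\<integral>\<^sup>+v. \<integral>\<^sup>+u. ennreal (1 / (1 + (lam * (c - (2 * v\<^sup>2 + 3 / 2 * u\<^sup>2)))\<^sup>2)) \<partial>lborel \<partial>lborel) \<le> ennreal (pi\<^sup>2 / lam)"
proof -
  let ?g = "\<lambda>x::real. 1 / (1 + (lam * (c - x))\<^sup>2)"
  let ?f = "\<lambda>v. \<integral>\<^sup>+u. ennreal (?g (2 * v\<^sup>2 + 3 / 2 * u\<^sup>2)) \<partial>lborel"
  \<comment> \<open>Along a fixed slope \<open>w = u / v\<close> the quadratic form is a multiple of
    \<open>v^2\<close>, and the factor \<open>v\<close> from the substitution makes the integrand an
    exact derivative.\<close>
  have inner: "(\<integral>\<^sup>+v. ennreal (v * ?g (2 * v\<^sup>2 + 3 / 2 * (v * w)\<^sup>2)) * indicator {0..} v \<partial>lborel) \<le> ennreal (pi / (2 * lam)) * ennreal (1 / (1 + w\<^sup>2))" for w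
  proof -
    define A where "A = 2 + 3 / 2 * w\<^sup>2"
    have A: "A > 0" "A \<ge> 1 + w\<^sup>2"
    proof -
      define x where "x = w\<^sup>2"
      have "x \<ge> 0" by (simp add: x_def)
      then show "A > 0" "A \<ge> 1 + w\<^sup>2" unfolding A_def x_def[symmetric] by auto
    qed
    have Av: "2 * v\<^sup>2 + 3 / 2 * (v * w)\<^sup>2 = A * v\<^sup>2" for v by (simp add: A_def algebra_simps power_mult_distrib)
    let ?F = "\<lambda>v. 1 / (2 * A * lam) * arctan (lam * (A * v\<^sup>2 - c))"
    have D: "DERIV ?F v :> v * ?g (A * v\<^sup>2)" for v
    proof -
      have "((\<lambda>v. arctan (lam * (A * v\<^sup>2 - c))) has_real_derivative ((2 * A * lam) * v / (1 + (lam * (A * v\<^sup>2 - c))\<^sup>2))) (at v)"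
        by (auto intro!: derivative_eq_intros simp: inverse_eq_divide)
      from DERIV_cmult[OF this, of "1 / (2 * A * lam)"] show ?thesis
        using assms A(1) by (simp add: power_mult_distrib power2_commute[of c])
    qed
    have "(\<integral>\<^sup>+v. ennreal (v * ?g (A * v\<^sup>2)) * indicator {0..} v \<partial>lborel) = ennreal (1 / (2 * A * lam) * (pi / 2) - ?F 0)"
    proof (rule nn_integral_FTC_atLeast[OF _ D])
      have "filterlim (\<lambda>v. lam * (A * v\<^sup>2 - c)) at_top at_top" using assms A(1) by real_asymp
      then show "(?F \<longlongrightarrow> 1 / (2 * A * lam) * (pi / 2)) at_top"
        by (intro tendsto_intros filterlim_compose[OF tendsto_arctan_at_top])
    qed (use assms in auto)
    also have "1 / (2 * A * lam) * (pi / 2) - ?F 0 = 1 / (2 * A * lam) * (pi / 2 - arctan (lam * (A * 0\<^sup>2 - c)))"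
      by (simp add: algebra_simps)
    \<comment> \<open>The difference of \<open>pi / 2\<close> and an arctangent is at most
      \<open>pi\<close> whatever \<open>c\<close> is, so the bound is uniform in the centre.
      Bounding \<open>A\<close> below by \<open>1 + w^2\<close> leaves an integrable function of the
      slope.\<close>
    also have "ennreal \<dots> \<le> ennreal (1 / (2 * (1 + w\<^sup>2) * lam) * pi)"
      using A assms arctan_lbound[of "lam * (A * 0\<^sup>2 - c)"] arctan_ubound[of "lam * (A * 0\<^sup>2 - c)"]
      by (intro ennreal_leI mult_mono divide_left_mono mult_right_mono mult_left_mono mult_pos_pos) (auto simp: add_pos_nonneg)
    also have "\<dots> = ennreal (pi / (2 * lam)) * ennreal (1 / (1 + w\<^sup>2))"
      using assms by (subst ennreal_mult[symmetric]) (auto simp: field_simps)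
    finally show ?thesis unfolding Av .
  qed
  have even: "(\<integral>\<^sup>+v. ?f v \<partial>lborel) = 2 * (\<integral>\<^sup>+v. ?f v * indicator {0<..} v \<partial>lborel)"
    using nn_integral_even[of ?f] by simp
  have "(\<integral>\<^sup>+v. ?f v * indicator {0<..} v \<partial>lborel) \<le>
     (\<integral>\<^sup>+v. \<integral>\<^sup>+w. ennreal (v * ?g (2 * v\<^sup>2 + 3 / 2 * (v * w)\<^sup>2)) * indicator {0..} v \<partial>lborel \<partial>lborel)"
  proof (rule nn_integral_mono)
    fix v :: real
    show "?f v * indicator {0<..} v \<le> (\<integral>\<^sup>+w. ennreal (v * ?g (2 * v\<^sup>2 + 3 / 2 * (v * w)\<^sup>2)) * indicator {0..} v \<partial>lborel)"
    proof (cases "v > 0")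
      case True
      have "?f v = ennreal v * (\<integral>\<^sup>+w. ennreal (?g (2 * v\<^sup>2 + 3 / 2 * (v * w)\<^sup>2)) \<partial>lborel)"
        using nn_integral_real_affine[of "\<lambda>u. ennreal (?g (2 * v\<^sup>2 + 3 / 2 * u\<^sup>2))" v 0] True
        by (simp only: add_0 abs_of_pos) simp
      also have "\<dots> = (\<integral>\<^sup>+w. ennreal v * ennreal (?g (2 * v\<^sup>2 + 3 / 2 * (v * w)\<^sup>2)) \<partial>lborel)"
        by (rule nn_integral_cmult[symmetric]) measurable
      also have "\<dots> = (\<integral>\<^sup>+w. ennreal (v * ?g (2 * v\<^sup>2 + 3 / 2 * (v * w)\<^sup>2)) \<partial>lborel)"
        using True by (intro nn_integral_cong ennreal_mult[symmetric]) auto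
      finally show ?thesis using True by simp
    qed simp
  qed
  also have "\<dots> = (\<integral>\<^sup>+w. \<integral>\<^sup>+v. ennreal (v * ?g (2 * v\<^sup>2 + 3 / 2 * (v * w)\<^sup>2)) * indicator {0..} v \<partial>lborel \<partial>lborel)"
    by (rule lborel_pair.Fubini') measurable
  also have "\<dots> \<le> (\<integral>\<^sup>+w. ennreal (pi / (2 * lam)) * ennreal (1 / (1 + w\<^sup>2)) \<partial>lborel)"
    by (intro nn_integral_mono inner)
  also have "\<dots> = ennreal (pi / (2 * lam)) * ennreal pi"
    by (simp add: nn_integral_cmult nn_integral_inv_one_plus_square)
  also have "\<dots> = ennreal (pi\<^sup>2 / (2 * lam))"
    using assms by (simp add: ennreal_mult'[symmetric] power2_eq_square)
  finally have "(\<integral>\<^sup>+v. ?f v * indicator {0<..} v \<partial>lborel) \<le> ennreal (pi\<^sup>2 / (2 * lam))" .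
  then have "(\<integral>\<^sup>+v. ?f v \<partial>lborel) \<le> 2 * ennreal (pi\<^sup>2 / (2 * lam))"
    unfolding even by (intro mult_left_mono) auto
  then show ?thesis by (simp add: two_times_ennreal)
qed

section \<open>Schur bounds for the kernels\<close>

definition fresnel :: "real \<Rightarrow> real \<Rightarrow> complex" where
  "fresnel R \<mu> = (LINT y:{-R..R}|lborel. cis (\<mu> * y\<^sup>2))"

lemma borel_measurable_cis [measurable (raw)]:
  assumes "f \<in> borel_measurable M"
  shows "(\<lambda>x. cis (f x)) \<in> borel_measurable M"
  by (rule borel_measurable_continuous_on[OF _ assms]) (auto simp: cis_conv_exp intro!: continuous_intros)

lemma borel_measurable_fresnel [measurable]: "fresnel R \<in> borel_measurable borel"
  unfolding fresnel_def set_lebesgue_integral_def by measurable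

lemma norm_fresnel_le: "\<mu> \<noteq> 0 \<Longrightarrow> norm (fresnel R \<mu>) \<le> (1 + 4 * pi) / sqrt \<bar>\<mu>\<bar>"
  unfolding fresnel_def by (rule norm_integral_cis_quadratic_le)

text \<open>The Gaussian is traded for a rational weight, because the integrals that arise
  afterwards then have arctangent primitives.\<close>

lemma exp_minus_half_square_le: "exp (- (z\<^sup>2) / 2) \<le> 2 / (1 + (z::real)\<^sup>2)"
proof -
  define x where "x = z\<^sup>2 / 2"
  have "1 + z\<^sup>2 \<le> 2 * (1 + x)" by (simp add: x_def)
  also have "\<dots> \<le> 2 * exp x" by (intro mult_left_mono exp_ge_add_one_self) auto
  finally have "1 + z\<^sup>2 \<le> 2 * exp x" .
  moreover have "1 + z\<^sup>2 > 0" by (simp add: add_pos_nonneg)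
  moreover have "exp (- (z\<^sup>2) / 2) = 1 / exp x" by (simp add: x_def exp_minus inverse_eq_divide)
  ultimately show ?thesis by (simp add: pos_divide_le_eq pos_le_divide_eq)
qed

lemma kernel_le:
  assumes "\<mu> \<noteq> 0"
  shows "exp (- (z\<^sup>2) / 2) * norm (fresnel R \<mu>) \<le> 2 * (1 + 4 * pi) * (1 / (1 + z\<^sup>2) * (1 / sqrt \<bar>\<mu>\<bar>))"
proof -
  have "exp (- (z\<^sup>2) / 2) * norm (fresnel R \<mu>) \<le> 2 / (1 + z\<^sup>2) * ((1 + 4 * pi) / sqrt \<bar>\<mu>\<bar>)"
    by (intro mult_mono exp_minus_half_square_le norm_fresnel_le assms) (auto simp: add_nonneg_nonneg)
  then show ?thesis by (simp add: mult_ac)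
qed

text \<open>Replacing both \<open>a\<close> and \<open>b\<close> by the smaller one,
  \<open>x\<close>, only increases the left side. With \<open>v = sqrt lam * x\<close> the weight
  becomes \<open>1 / (1 + v^4)\<close>, and weakening it to a multiple of \<open>1 / (1 + v)\<close>
  still leaves an integrable tail of order \<open>x powr (-3/2)\<close>. The sum on the right
  decouples the two factors of P, so each can be integrated by a translation or a
  reflection.\<close>

lemma inv_one_plus_square_prod_le:
  fixes a b lam :: real
  assumes "a > 0" "b > 0" "lam > 0"
  shows "1 / (1 + (lam * (a * b))\<^sup>2) * (1 / sqrt a)
    \<le> 2 * (1 / (sqrt a * (1 + sqrt lam * a)) + 1 / (sqrt b * (1 + sqrt lam * b)))"
proof -
  have one: "1 / (1 + (lam * (a * b))\<^sup>2) * (1 / sqrt a) \<le> 2 * (1 / (sqrt x * (1 + sqrt lam * x)))"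
    if x: "0 < x" "x \<le> a" "x \<le> b" for x
  proof -
    define v where "v = sqrt lam * x"
    have v: "v > 0" "v^4 = (lam * (x * x))\<^sup>2"
    proof -
      have "v^4 = (v\<^sup>2)\<^sup>2" by simp
      also have "v\<^sup>2 = lam * (x * x)" using assms by (simp add: v_def power_mult_distrib power2_eq_square)
      finally show "v^4 = (lam * (x * x))\<^sup>2" .
    qed (use x assms in \<open>simp add: v_def\<close>)
    have v1: "v \<le> 1 + v^4"
    proof (cases "v \<le> 1")
      case False
      then have "v ^ 1 \<le> v ^ 4" by (intro power_increasing) auto
      then show ?thesis by simp
    qed (simp add: add_increasing2)
    have le: "1 + v \<le> 2 * (1 + w)" if "v \<le> 1 + w" "0 \<le> w" for w
      using that by simp
    have "1 + v \<le> 2 * (1 + v^4)"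
      by (rule le[OF v1]) simp
    also have "v^4 \<le> (lam * (a * b))\<^sup>2"
      unfolding v(2) using x assms by (intro power_mono mult_left_mono mult_mono) auto
    finally have "1 + v \<le> 2 * (1 + (lam * (a * b))\<^sup>2)" by simp
    moreover have "1 + (lam * (a * b))\<^sup>2 > 0" by (simp add: add_pos_nonneg)
    ultimately have "1 / (1 + (lam * (a * b))\<^sup>2) \<le> 2 / (1 + v)"
      using v(1) by (simp add: divide_simps)
    moreover have "1 / sqrt a \<le> 1 / sqrt x" using x by (intro divide_left_mono) auto
    ultimately have "1 / (1 + (lam * (a * b))\<^sup>2) * (1 / sqrt a) \<le> 2 / (1 + v) * (1 / sqrt x)"
      using v(1) assms by (intro mult_mono) auto
    then show ?thesis by (simp add: v_def mult_ac)
  qed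
  have nn: "0 \<le> 1 / (sqrt x * (1 + sqrt lam * x))" if "x > 0" for x using that assms by simp
  have add: "X \<le> 2 * (A + B)" "X \<le> 2 * (B + A)" if "X \<le> 2 * A" "0 \<le> B" for X A B :: real
    using that by auto
  show ?thesis
    using add(1)[OF one[of a] nn[of b]] add(2)[OF one[of b] nn[of a]] assms by (cases "a \<le> b") auto
qed

text \<open>The Fresnel factor contributes \<open>lam powr (-1/2)\<close>. The remaining majorant
  \<open>q\<close> has effective width \<open>lam powr (-1/2)\<close> around \<open>s = t\<close>
  and \<open>s = -t\<close>, and its inverse square root singularity integrates over such a width to
  order \<open>lam powr (-1/4)\<close>. The null set of these two points is discarded.\<close>

lemma schur_kernel_line:
  fixes t R lam :: real
  assumes lam: "lam > 0"
  shows "(\<integral>\<^sup>+s. ennreal (exp (- ((lam * (t\<^sup>2 - s\<^sup>2))\<^sup>2) / 2) * norm (fresnel R (lam * (t - s)))) \<partial>lborel)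
     \<le> ennreal (16 * pi * (1 + 4 * pi) * lam powr (-3/4))"
proof -
  define q where "q u = 1 / (sqrt u * (1 + sqrt lam * u))" for u
  have [measurable]: "q \<in> borel_measurable borel" unfolding q_def by measurable
  define c where "c = 2 * (1 + 4 * pi) / sqrt lam * 2"
  have c: "c \<ge> 0" using lam by (simp add: c_def)
  have qn: "0 \<le> q \<bar>u\<bar>" for u using lam by (simp add: q_def)
  have "(\<integral>\<^sup>+s. ennreal (exp (- ((lam * (t\<^sup>2 - s\<^sup>2))\<^sup>2) / 2) * norm (fresnel R (lam * (t - s)))) \<partial>lborel)
     \<le> (\<integral>\<^sup>+s. (ennreal c * (ennreal (q \<bar>t - s\<bar>) + ennreal (q \<bar>t + s\<bar>))) \<partial>lborel)"
  proof (intro nn_integral_mono_AE)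
    show "AE s in lborel. ennreal (exp (- ((lam * (t\<^sup>2 - s\<^sup>2))\<^sup>2) / 2) * norm (fresnel R (lam * (t - s))))
       \<le> ennreal c * (ennreal (q \<bar>t - s\<bar>) + ennreal (q \<bar>t + s\<bar>))"
      using AE_lborel_singleton[of t] AE_lborel_singleton[of "-t"]
    proof eventually_elim
      case (elim s)
      let ?a = "\<bar>t - s\<bar>" and ?b = "\<bar>t + s\<bar>"
      have ab: "?a > 0" "?b > 0" using elim by auto
      have sq: "(lam * (t\<^sup>2 - s\<^sup>2))\<^sup>2 = (lam * (?a * ?b))\<^sup>2"
      proof -
        have "t\<^sup>2 - s\<^sup>2 = (t - s) * (t + s)" by (simp add: algebra_simps power2_eq_square)
        then have "lam * (?a * ?b) = \<bar>lam * (t\<^sup>2 - s\<^sup>2)\<bar>" using lam by (simp add: abs_mult)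
        then show ?thesis by (simp only: power2_abs)
      qed
      have "exp (- ((lam * (t\<^sup>2 - s\<^sup>2))\<^sup>2) / 2) * norm (fresnel R (lam * (t - s)))
         \<le> 2 * (1 + 4 * pi) * (1 / (1 + (lam * (t\<^sup>2 - s\<^sup>2))\<^sup>2) * (1 / sqrt \<bar>lam * (t - s)\<bar>))"
        using elim lam by (intro kernel_le) auto
      also have "\<dots> = 2 * (1 + 4 * pi) / sqrt lam * (1 / (1 + (lam * (?a * ?b))\<^sup>2) * (1 / sqrt ?a))"
        unfolding sq using lam by (simp add: abs_mult real_sqrt_mult)
      also have "\<dots> \<le> 2 * (1 + 4 * pi) / sqrt lam * (2 * (q ?a + q ?b))"
        unfolding q_def using lam by (intro mult_left_mono inv_one_plus_square_prod_le ab) auto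
      also have "\<dots> = c * (q ?a + q ?b)" by (simp only: c_def mult.assoc)
      finally show ?case
        using c qn[of "t-s"] qn[of "t+s"] by (simp add: ennreal_mult'[symmetric] ennreal_plus[symmetric] ennreal_leI del: ennreal_plus)
    qed
  qed
  also have "\<dots> = ennreal c * ((\<integral>\<^sup>+s. ennreal (q \<bar>t - s\<bar>) \<partial>lborel) + (\<integral>\<^sup>+s. ennreal (q \<bar>t + s\<bar>) \<partial>lborel))"
    by (subst nn_integral_cmult, measurable, subst nn_integral_add) auto
  also have "(\<integral>\<^sup>+s. ennreal (q \<bar>t - s\<bar>) \<partial>lborel) = (\<integral>\<^sup>+s. ennreal (q \<bar>s\<bar>) \<partial>lborel)"
    by (rule nn_integral_reflect[of "\<lambda>s. ennreal (q \<bar>s\<bar>)"]) measurable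
  also have "(\<integral>\<^sup>+s. ennreal (q \<bar>t + s\<bar>) \<partial>lborel) = (\<integral>\<^sup>+s. ennreal (q \<bar>s\<bar>) \<partial>lborel)"
    by (rule nn_integral_translate[of "\<lambda>s. ennreal (q \<bar>s\<bar>)"]) measurable
  also have "(\<integral>\<^sup>+s. ennreal (q \<bar>s\<bar>) \<partial>lborel) = 2 * (\<integral>\<^sup>+u. ennreal (q u * indicator {0<..} u) \<partial>lborel)"
    using nn_integral_even[of "\<lambda>s. ennreal (q s)"] by (simp add: nn_integral_set_ennreal)
  also have "\<dots> = ennreal (2 * (pi / sqrt (sqrt lam)))"
    unfolding q_def using nn_integral_inv_sqrt_times_inv_linear[of "sqrt lam"] lam by (simp add: two_times_ennreal)
  also have "ennreal c * (ennreal (2 * (pi / sqrt (sqrt lam))) + ennreal (2 * (pi / sqrt (sqrt lam))))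
       = ennreal (16 * pi * (1 + 4 * pi) * (1 / (sqrt lam * sqrt (sqrt lam))))"
    using lam c by (simp add: ennreal_mult'[symmetric] ennreal_plus[symmetric] c_def field_simps del: ennreal_plus)
  also have "1 / (sqrt lam * sqrt (sqrt lam)) = lam powr (-3/4)"
    using lam by (simp add: powr_half_sqrt[symmetric] powr_powr powr_add[symmetric] powr_minus divide_inverse[symmetric] inverse_eq_divide)
  finally show ?thesis .
qed

text \<open>For a fixed sum \<open>p\<close> the Gaussian factor integrates over the plane to at
  most a multiple of \<open>1 / lam\<close>, uniformly in \<open>p\<close> and \<open>q0\<close>.
  What remains is the Fresnel singularity in \<open>p\<close>, of size
  \<open>lam powr (-1/2)\<close>, integrated over a bounded interval; without the cube it would
  diverge at infinity.\<close>

lemma schur_kernel_space: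
  fixes p0 q0 R lam :: real
  assumes lam: "lam > 0" and R: "R > 0" and p0: "\<bar>p0\<bar> \<le> 3 * R"
  defines "I \<equiv> (\<lambda>s. indicator {-R..R} s :: ennreal)"
  shows "(\<integral>\<^sup>+s1. \<integral>\<^sup>+s2. \<integral>\<^sup>+s3. ennreal (exp (- ((lam * (q0 - (s1\<^sup>2 + s2\<^sup>2 + s3\<^sup>2)))\<^sup>2) / 2)
            * norm (fresnel R (lam * (p0 - (s1 + s2 + s3))))) * (I s1 * I s2 * I s3) \<partial>lborel \<partial>lborel \<partial>lborel)
     \<le> ennreal (8 * pi\<^sup>2 * (1 + 4 * pi) * sqrt (7 * R) * lam powr (-3/2))"
proof -
  \<comment> \<open>Both \<open>p0\<close> and \<open>p\<close> lie in \<open>[-3R, 3R]\<close>, so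
    they differ by at most \<open>6 * R\<close>; the larger \<open>7 * R\<close> makes membership in
    the open interval immediate.\<close>
  define h where "h p = 2 * (1 + 4 * pi) / sqrt lam * (1 / sqrt \<bar>p0 - p\<bar> * indicator {0<..<7 * R} \<bar>p0 - p\<bar>)" for p
  define j where "j Q = 1 / (1 + (lam * (q0 - Q))\<^sup>2)" for Q
  have [measurable]: "h \<in> borel_measurable borel" "j \<in> borel_measurable borel"
    unfolding h_def j_def by measurable
  have hn: "h p \<ge> 0" for p using lam by (simp add: h_def)
  have jn: "j p \<ge> 0" for p by (simp add: j_def)
  txt \<open>With \<open>p = s\<^sub>1 + s\<^sub>2 + s\<^sub>3\<close> in place of \<open>s\<^sub>3\<close>, completing squares turns \<open>\<Sum> s\<^sub>i\<^sup>2\<close>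
    into \<open>2v\<^sup>2 + 3/2 u\<^sup>2 + p\<^sup>2/3\<close>.\<close>
  have s3: "(\<integral>\<^sup>+s3. ennreal (exp (- ((lam * (q0 - (s1\<^sup>2 + s2\<^sup>2 + s3\<^sup>2)))\<^sup>2) / 2)
            * norm (fresnel R (lam * (p0 - (s1 + s2 + s3))))) * (I s1 * I s2 * I s3) \<partial>lborel)
     \<le> (\<integral>\<^sup>+p. ennreal (h p) * ennreal (j (s1\<^sup>2 + s2\<^sup>2 + (p - (s1 + s2))\<^sup>2)) \<partial>lborel)" for s1 s2
  proof -
    have "(\<integral>\<^sup>+s3. ennreal (exp (- ((lam * (q0 - (s1\<^sup>2 + s2\<^sup>2 + s3\<^sup>2)))\<^sup>2) / 2)
            * norm (fresnel R (lam * (p0 - (s1 + s2 + s3))))) * (I s1 * I s2 * I s3) \<partial>lborel)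
       \<le> (\<integral>\<^sup>+s3. ennreal (h (s1 + s2 + s3)) * ennreal (j (s1\<^sup>2 + s2\<^sup>2 + (s1 + s2 + s3 - (s1 + s2))\<^sup>2)) \<partial>lborel)"
    proof (intro nn_integral_mono_AE)
      show "AE s3 in lborel. ennreal (exp (- ((lam * (q0 - (s1\<^sup>2 + s2\<^sup>2 + s3\<^sup>2)))\<^sup>2) / 2)
            * norm (fresnel R (lam * (p0 - (s1 + s2 + s3))))) * (I s1 * I s2 * I s3)
          \<le> ennreal (h (s1 + s2 + s3)) * ennreal (j (s1\<^sup>2 + s2\<^sup>2 + (s1 + s2 + s3 - (s1 + s2))\<^sup>2))"
        using AE_lborel_singleton[of "p0 - (s1 + s2)"]
      proof eventually_elim
        case (elim s3)
        let ?p = "s1 + s2 + s3" and ?Q = "s1\<^sup>2 + s2\<^sup>2 + s3\<^sup>2"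
        show ?case
        proof (cases "s1 \<in> {-R..R} \<and> s2 \<in> {-R..R} \<and> s3 \<in> {-R..R}")
          case True
          have "\<bar>p0 - ?p\<bar> > 0" using elim by auto
          moreover have "\<bar>p0 - ?p\<bar> < 7 * R" using True p0 R by (simp add: abs_le_iff abs_less_iff)
          ultimately have hp: "h ?p = 2 * (1 + 4 * pi) / sqrt lam * (1 / sqrt \<bar>p0 - ?p\<bar>)"
            by (simp add: h_def)
          have "exp (- ((lam * (q0 - ?Q))\<^sup>2) / 2) * norm (fresnel R (lam * (p0 - ?p)))
             \<le> 2 * (1 + 4 * pi) * (1 / (1 + (lam * (q0 - ?Q))\<^sup>2) * (1 / sqrt \<bar>lam * (p0 - ?p)\<bar>))"
            using elim lam by (intro kernel_le) auto
          also have "\<dots> = h ?p * j ?Q"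
            unfolding hp j_def using lam by (simp add: abs_mult real_sqrt_mult)
          finally show ?thesis
            using True hn jn by (simp add: I_def ennreal_mult[symmetric] ennreal_leI)
        qed (auto simp: I_def)
      qed
    qed
    also have "\<dots> = (\<integral>\<^sup>+p. ennreal (h p) * ennreal (j (s1\<^sup>2 + s2\<^sup>2 + (p - (s1 + s2))\<^sup>2)) \<partial>lborel)"
      by (rule nn_integral_translate[of "\<lambda>p. ennreal (h p) * ennreal (j (s1\<^sup>2 + s2\<^sup>2 + (p - (s1 + s2))\<^sup>2))" "s1 + s2"]) measurable
    finally show ?thesis .
  qed
  have J: "(\<integral>\<^sup>+s1. \<integral>\<^sup>+s2. ennreal (j (s1\<^sup>2 + s2\<^sup>2 + (p - (s1 + s2))\<^sup>2)) \<partial>lborel \<partial>lborel) \<le> ennreal (pi\<^sup>2 / lam)" for p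
  proof -
    have "(\<integral>\<^sup>+s1. \<integral>\<^sup>+s2. ennreal (j (s1\<^sup>2 + s2\<^sup>2 + (p - (s1 + s2))\<^sup>2)) \<partial>lborel \<partial>lborel)
      = (\<integral>\<^sup>+s1. \<integral>\<^sup>+v. ennreal (j (2 * v\<^sup>2 + (3/2 * (s1 - p/3)\<^sup>2 + p\<^sup>2/3))) \<partial>lborel \<partial>lborel)"
    proof (rule nn_integral_cong)
      fix s1 :: real
      have "(\<integral>\<^sup>+s2. ennreal (j (s1\<^sup>2 + s2\<^sup>2 + (p - (s1 + s2))\<^sup>2)) \<partial>lborel)
         = (\<integral>\<^sup>+v. ennreal (j (s1\<^sup>2 + ((p - s1)/2 + v)\<^sup>2 + (p - (s1 + ((p - s1)/2 + v)))\<^sup>2)) \<partial>lborel)"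
        by (rule nn_integral_translate[of "\<lambda>s2. ennreal (j (s1\<^sup>2 + s2\<^sup>2 + (p - (s1 + s2))\<^sup>2))", symmetric]) measurable
      also have "\<dots> = (\<integral>\<^sup>+v. ennreal (j (2 * v\<^sup>2 + (3/2 * (s1 - p/3)\<^sup>2 + p\<^sup>2/3))) \<partial>lborel)"
        by (intro nn_integral_cong arg_cong[where f="\<lambda>x. ennreal (j x)"]) (simp add: field_simps power2_eq_square)
      finally show "(\<integral>\<^sup>+s2. ennreal (j (s1\<^sup>2 + s2\<^sup>2 + (p - (s1 + s2))\<^sup>2)) \<partial>lborel)
         = (\<integral>\<^sup>+v. ennreal (j (2 * v\<^sup>2 + (3/2 * (s1 - p/3)\<^sup>2 + p\<^sup>2/3))) \<partial>lborel)" .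
    qed
    also have "\<dots> = (\<integral>\<^sup>+v. \<integral>\<^sup>+s1. ennreal (j (2 * v\<^sup>2 + (3/2 * (s1 - p/3)\<^sup>2 + p\<^sup>2/3))) \<partial>lborel \<partial>lborel)"
      by (rule lborel_pair.Fubini') measurable
    also have "\<dots> = (\<integral>\<^sup>+v. \<integral>\<^sup>+u. ennreal (j (2 * v\<^sup>2 + (3/2 * (p/3 + u - p/3)\<^sup>2 + p\<^sup>2/3))) \<partial>lborel \<partial>lborel)"
      by (intro nn_integral_cong nn_integral_translate[symmetric]) measurable
    also have "\<dots> = (\<integral>\<^sup>+v. \<integral>\<^sup>+u. ennreal (1 / (1 + (lam * ((q0 - p\<^sup>2/3) - (2 * v\<^sup>2 + 3 / 2 * u\<^sup>2)))\<^sup>2)) \<partial>lborel \<partial>lborel)"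
      by (simp add: j_def algebra_simps)
    also have "\<dots> \<le> ennreal (pi\<^sup>2 / lam)" by (rule nn_integral_inv_one_plus_square_ellipse_le[OF lam])
    finally show ?thesis .
  qed
  have "(\<integral>\<^sup>+s1. \<integral>\<^sup>+s2. \<integral>\<^sup>+s3. ennreal (exp (- ((lam * (q0 - (s1\<^sup>2 + s2\<^sup>2 + s3\<^sup>2)))\<^sup>2) / 2)
            * norm (fresnel R (lam * (p0 - (s1 + s2 + s3))))) * (I s1 * I s2 * I s3) \<partial>lborel \<partial>lborel \<partial>lborel)
    \<le> (\<integral>\<^sup>+s1. \<integral>\<^sup>+s2. \<integral>\<^sup>+p. ennreal (h p) * ennreal (j (s1\<^sup>2 + s2\<^sup>2 + (p - (s1 + s2))\<^sup>2)) \<partial>lborel \<partial>lborel \<partial>lborel)"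
    by (intro nn_integral_mono s3)
  \<comment> \<open>Moving \<open>p\<close> outermost pulls \<open>h p\<close> out of the integral
    over the plane, to which the uniform bound \<open>J\<close> applies.\<close>
  also have "\<dots> = (\<integral>\<^sup>+s1. \<integral>\<^sup>+p. \<integral>\<^sup>+s2. ennreal (h p) * ennreal (j (s1\<^sup>2 + s2\<^sup>2 + (p - (s1 + s2))\<^sup>2)) \<partial>lborel \<partial>lborel \<partial>lborel)"
    by (intro nn_integral_cong lborel_pair.Fubini') measurable
  also have "\<dots> = (\<integral>\<^sup>+p. \<integral>\<^sup>+s1. \<integral>\<^sup>+s2. ennreal (h p) * ennreal (j (s1\<^sup>2 + s2\<^sup>2 + (p - (s1 + s2))\<^sup>2)) \<partial>lborel \<partial>lborel \<partial>lborel)"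
    by (rule lborel_pair.Fubini') measurable
  also have "\<dots> = (\<integral>\<^sup>+p. ennreal (h p) * (\<integral>\<^sup>+s1. \<integral>\<^sup>+s2. ennreal (j (s1\<^sup>2 + s2\<^sup>2 + (p - (s1 + s2))\<^sup>2)) \<partial>lborel \<partial>lborel) \<partial>lborel)"
    by (simp add: nn_integral_cmult)
  also have "\<dots> \<le> (\<integral>\<^sup>+p. ennreal (h p) * ennreal (pi\<^sup>2 / lam) \<partial>lborel)"
    by (intro nn_integral_mono mult_left_mono J) auto
  also have "\<dots> = (\<integral>\<^sup>+p. ennreal (h p) \<partial>lborel) * ennreal (pi\<^sup>2 / lam)"
    by (rule nn_integral_multc) measurable
  also have "(\<integral>\<^sup>+p. ennreal (h p) \<partial>lborel) = ennreal (2 * (1 + 4 * pi) / sqrt lam * (4 * sqrt (7 * R)))"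
  proof -
    have "(\<integral>\<^sup>+p. ennreal (h p) \<partial>lborel) = (\<integral>\<^sup>+p. ennreal (2 * (1 + 4 * pi) / sqrt lam) * ennreal (1 / sqrt \<bar>p0 - p\<bar> * indicator {0<..<7 * R} \<bar>p0 - p\<bar>) \<partial>lborel)"
      unfolding h_def using lam by (intro nn_integral_cong ennreal_mult) auto
    also have "\<dots> = ennreal (2 * (1 + 4 * pi) / sqrt lam) * (\<integral>\<^sup>+p. ennreal (1 / sqrt \<bar>p0 - p\<bar> * indicator {0<..<7 * R} \<bar>p0 - p\<bar>) \<partial>lborel)"
      by (rule nn_integral_cmult) measurable
    also have "(\<integral>\<^sup>+p. ennreal (1 / sqrt \<bar>p0 - p\<bar> * indicator {0<..<7 * R} \<bar>p0 - p\<bar>) \<partial>lborel)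
       = (\<integral>\<^sup>+u. ennreal (1 / sqrt \<bar>u\<bar> * indicator {0<..<7 * R} \<bar>u\<bar>) \<partial>lborel)"
      by (rule nn_integral_reflect[of "\<lambda>u. ennreal (1 / sqrt \<bar>u\<bar> * indicator {0<..<7 * R} \<bar>u\<bar>)"]) measurable
    also have "\<dots> = 2 * (\<integral>\<^sup>+u. ennreal (1 / sqrt u * indicator {0<..<7 * R} u) * indicator {0<..} u \<partial>lborel)"
      by (rule nn_integral_even) measurable
    also have "(\<integral>\<^sup>+u. ennreal (1 / sqrt u * indicator {0<..<7 * R} u) * indicator {0<..} u \<partial>lborel)
        = (\<integral>\<^sup>+u. ennreal (1 / sqrt u * indicator {0<..<7 * R} u) \<partial>lborel)"
      by (intro nn_integral_cong) (auto simp: indicator_def)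
    also have "\<dots> = ennreal (2 * sqrt (7 * R))"
      using R by (intro nn_integral_inv_sqrt) auto
    also have "2 * \<dots> = ennreal (4 * sqrt (7 * R))" by (simp add: two_times_ennreal)
    also have "ennreal (2 * (1 + 4 * pi) / sqrt lam) * \<dots> = ennreal (2 * (1 + 4 * pi) / sqrt lam * (4 * sqrt (7 * R)))"
      using R lam by (intro ennreal_mult[symmetric]) auto
    finally show ?thesis .
  qed
  also have "ennreal (2 * (1 + 4 * pi) / sqrt lam * (4 * sqrt (7 * R))) * ennreal (pi\<^sup>2 / lam)
      = ennreal (8 * pi\<^sup>2 * (1 + 4 * pi) * sqrt (7 * R) * (1 / (lam * sqrt lam)))"
    using R lam by (subst ennreal_mult[symmetric]) (auto simp: mult_ac)
  also have "1 / (lam * sqrt lam) = lam powr (-3/2)"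
  proof -
    have "lam * sqrt lam = lam powr (3/2)"
      using lam powr_add[of lam 1 "1/2"] by (simp add: powr_half_sqrt)
    then show ?thesis using lam powr_minus_divide[of lam "3/2"] by simp
  qed
  finally show ?thesis .
qed

section \<open>The operator without amplitude\<close>

lemma (in pair_sigma_finite)
  fixes f :: "_ \<Rightarrow> complex" and g :: "_ \<Rightarrow> complex"
  assumes f: "integrable M1 f" and g: "integrable M2 g"
  shows integrable_fst_times_snd: "integrable (M1 \<Otimes>\<^sub>M M2) (\<lambda>p. f (fst p) * g (snd p))"
    and integral_fst_times_snd: "(LINT p|(M1 \<Otimes>\<^sub>M M2). f (fst p) * g (snd p)) = (LINT x|M1. f x) * (LINT y|M2. g y)"
proof -
  have [measurable]: "f \<in> borel_measurable M1" "g \<in> borel_measurable M2" using f g by auto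
  show i: "integrable (M1 \<Otimes>\<^sub>M M2) (\<lambda>p. f (fst p) * g (snd p))"
    by (rule Fubini_integrable) (use f g in \<open>auto simp: norm_mult\<close>)
  show "(LINT p|(M1 \<Otimes>\<^sub>M M2). f (fst p) * g (snd p)) = (LINT x|M1. f x) * (LINT y|M2. g y)"
    using integral_fst'[OF i] by simp
qed

text \<open>A density keeps the whole line as the underlying space and the Borel sets as the
  sigma-algebra, so measurability is the same as for \<open>lborel\<close> and for the normal
  distribution.\<close>

definition interval_measure_on :: "real \<Rightarrow> real measure" where
  "interval_measure_on R = density lborel (\<lambda>x. indicator {-R..R} x)"

definition square :: "real \<Rightarrow> (real \<times> real) measure" where
  "square R = interval_measure_on R \<Otimes>\<^sub>M interval_measure_on R"

lemma sets_interval_measure_on [measurable_cong, simp]: "sets (interval_measure_on R) = sets borel"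
  by (simp add: interval_measure_on_def)

lemma space_interval_measure_on [simp]: "space (interval_measure_on R) = UNIV"
  by (simp add: interval_measure_on_def)

lemma nn_integral_interval_measure_on:
  assumes [measurable]: "f \<in> borel_measurable borel"
  shows "(\<integral>\<^sup>+x. f x \<partial>interval_measure_on R) = (\<integral>\<^sup>+x. f x * indicator {-R..R} x \<partial>lborel)"
  unfolding interval_measure_on_def by (subst nn_integral_density) (auto simp: mult.commute)

lemma finite_measure_interval_measure_on: "finite_measure (interval_measure_on R)"
proof
  have "emeasure (interval_measure_on R) (space (interval_measure_on R)) = emeasure lborel {-R..R}"
    by (simp add: interval_measure_on_def emeasure_density)
  then show "emeasure (interval_measure_on R) (space (interval_measure_on R)) \<noteq> \<infinity>"
    by (simp add: emeasure_lborel_Icc_eq)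
qed

lemma integral_interval_measure_on:
  fixes f :: "real \<Rightarrow> complex"
  assumes [measurable]: "f \<in> borel_measurable borel"
  shows "(LINT x|interval_measure_on R. f x) = (LINT x:{-R..R}|lborel. f x)"
  unfolding interval_measure_on_def set_lebesgue_integral_def
  by (subst integral_density[where g="\<lambda>x. indicator {-R..R} x :: real", simplified, symmetric])
     (auto simp: ennreal_indicator)

text \<open>For \<open>R \<ge> 0\<close> the constant is the reciprocal of the smallest value of the
  standard normal density on the interval, taken at the endpoints.\<close>

lemma nn_integral_interval_le_normal:
  assumes [measurable]: "f \<in> borel_measurable borel"
  shows "(\<integral>\<^sup>+x. f x \<partial>interval_measure_on R)
    \<le> ennreal (sqrt (2 * pi) * exp (R\<^sup>2 / 2)) * (\<integral>\<^sup>+x. f x \<partial>std_normal_distribution)"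
proof -
  have "(\<integral>\<^sup>+x. f x \<partial>interval_measure_on R) = (\<integral>\<^sup>+x. f x * indicator {-R..R} x \<partial>lborel)"
    by (rule nn_integral_interval_measure_on) measurable
  also have "\<dots> \<le> (\<integral>\<^sup>+x. ennreal (sqrt (2 * pi) * exp (R\<^sup>2 / 2)) * (ennreal (std_normal_density x) * f x) \<partial>lborel)"
  proof (rule nn_integral_mono)
    fix x :: real
    show "f x * indicator {-R..R} x \<le> ennreal (sqrt (2 * pi) * exp (R\<^sup>2 / 2)) * (ennreal (std_normal_density x) * f x)"
    proof (cases "x \<in> {-R..R}")
      case True
      then have "\<bar>x\<bar>\<^sup>2 \<le> R\<^sup>2" by (intro power_mono) auto
      then have "0 \<le> R\<^sup>2 / 2 + - x\<^sup>2 / 2" by simp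
      then have "1 \<le> exp (R\<^sup>2 / 2 + - x\<^sup>2 / 2)" by simp
      also have "\<dots> = sqrt (2 * pi) * exp (R\<^sup>2 / 2) * std_normal_density x"
        unfolding std_normal_density_def exp_add by simp
      finally have "ennreal 1 * f x \<le> ennreal (sqrt (2 * pi) * exp (R\<^sup>2 / 2) * std_normal_density x) * f x"
        by (intro mult_right_mono ennreal_leI) auto
      then show ?thesis using True by (simp add: ennreal_mult' mult_ac)
    qed simp
  qed
  also have "\<dots> = ennreal (sqrt (2 * pi) * exp (R\<^sup>2 / 2)) * (\<integral>\<^sup>+x. f x \<partial>std_normal_distribution)"
    by (subst nn_integral_cmult) (auto simp: nn_integral_density)
  finally show ?thesis .
qed

text \<open>The weight is a product measure and the phase a sum, so the kernel factors; the
  \<open>x\<close> factor is the characteristic function of the standard normal law.\<close>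

lemma integral_cis_normal_interval:
  "(LINT w|(std_normal_distribution \<Otimes>\<^sub>M interval_measure_on R). cis (fst w * P + (snd w)\<^sup>2 * Q))
    = of_real (exp (- (P\<^sup>2) / 2)) * fresnel R Q"
proof -
  interpret N: prob_space std_normal_distribution by (rule prob_space_normal_density) simp
  interpret U: finite_measure "interval_measure_on R" by (rule finite_measure_interval_measure_on)
  interpret NU: pair_sigma_finite std_normal_distribution "interval_measure_on R" ..
  have "(LINT w|(std_normal_distribution \<Otimes>\<^sub>M interval_measure_on R). cis (fst w * P + (snd w)\<^sup>2 * Q))
     = (LINT w|(std_normal_distribution \<Otimes>\<^sub>M interval_measure_on R). cis (fst w * P) * cis ((snd w)\<^sup>2 * Q))"
    by (simp add: cis_mult)
  also have "\<dots> = (LINT x|std_normal_distribution. cis (x * P)) * (LINT y|interval_measure_on R. cis (y\<^sup>2 * Q))"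
    by (rule NU.integral_fst_times_snd)
       (auto intro!: N.integrable_const_bound[where B=1] U.integrable_const_bound[where B=1])
  also have "(LINT x|std_normal_distribution. cis (x * P)) = char std_normal_distribution P"
    by (simp add: char_def cis_conv_exp mult.commute)
  also have "\<dots> = of_real (exp (- (P\<^sup>2) / 2))" by (simp add: char_std_normal_distribution)
  also have "(LINT y|interval_measure_on R. cis (y\<^sup>2 * Q)) = fresnel R Q"
    by (subst integral_interval_measure_on) (auto simp: fresnel_def mult.commute)
  finally show ?thesis .
qed

text \<open>The Schur test runs with the normal weight in \<open>x\<close>, where the kernel is
  explicit and depends only on the differences of \<open>a\<close> and \<open>b\<close>; only
  afterwards is the bound transferred to the square. Leaving \<open>M\<close>, \<open>a\<close> and
  \<open>b\<close> general serves one variable and three variables alike.\<close>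

lemma extension_L2:
  fixes a b :: "'m \<Rightarrow> real" and G :: "'m \<Rightarrow> complex"
  assumes M: "sigma_finite_measure M" and [measurable]: "a \<in> borel_measurable M" "b \<in> borel_measurable M"
    and G: "integrable M G"
    and A [measurable]: "A \<in> sets M" and supp: "\<And>m. m \<notin> A \<Longrightarrow> G m = 0"
    and schur: "\<And>m. m \<in> A \<Longrightarrow>
      (\<integral>\<^sup>+m'. ennreal (exp (- ((lam * (a m - a m'))\<^sup>2) / 2) * norm (fresnel R (lam * (b m - b m')))) * indicator A m' \<partial>M) \<le> S"
  shows "(\<integral>\<^sup>+p. ennreal ((norm (LINT m|M. cis (lam * (fst p * a m + (snd p)\<^sup>2 * b m)) * G m))\<^sup>2) \<partial>square R)
      \<le> ennreal (sqrt (2 * pi) * exp (R\<^sup>2 / 2)) * (S * (\<integral>\<^sup>+m. ennreal ((norm (G m))\<^sup>2) \<partial>M))"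
proof -
  let ?W = "std_normal_distribution \<Otimes>\<^sub>M interval_measure_on R"
  interpret M: sigma_finite_measure M by fact
  interpret N: prob_space std_normal_distribution by (rule prob_space_normal_density) simp
  interpret U: finite_measure "interval_measure_on R" by (rule finite_measure_interval_measure_on)
  have W: "finite_measure ?W"
    by (rule finite_measure_pair_measure) unfold_locales
  have [measurable]: "G \<in> borel_measurable M" using G by simp
  define e where "e w m = cis (lam * (fst w * a m + (snd w)\<^sup>2 * b m))" for w m
  have em [measurable]: "(\<lambda>(w,m). e w m) \<in> borel_measurable ((borel \<Otimes>\<^sub>M borel) \<Otimes>\<^sub>M M)"
    unfolding e_def by measurable
  define F where "F p = ennreal ((norm (LINT m|M. e p m * G m))\<^sup>2)" for p
  have Fm [measurable]: "F \<in> borel_measurable (borel \<Otimes>\<^sub>M borel)" unfolding F_def by measurable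
  have "(\<integral>\<^sup>+p. F p \<partial>?W) \<le> S * (\<integral>\<^sup>+m. ennreal ((norm (G m))\<^sup>2) \<partial>M)"
    unfolding F_def
  proof (rule TTstar_schur[OF W M _ _ G A supp])
    show "(\<lambda>(w,m). e w m) \<in> borel_measurable (?W \<Otimes>\<^sub>M M)" by measurable
    fix m assume m: "m \<in> A"
    have "(LINT w|?W. e w m * cnj (e w m')) = of_real (exp (- ((lam * (a m - a m'))\<^sup>2) / 2)) * fresnel R (lam * (b m - b m'))" for m'
      unfolding integral_cis_normal_interval[symmetric]
      by (intro Bochner_Integration.integral_cong refl) (simp add: e_def cis_cnj cis_mult algebra_simps)
    then show "(\<integral>\<^sup>+m'. ennreal (norm (LINT w|?W. e w m * cnj (e w m'))) * indicator A m' \<partial>M) \<le> S"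
      using schur[OF m] by (simp add: norm_mult)
  qed (auto simp: e_def)
  moreover have "(\<integral>\<^sup>+p. F p \<partial>square R) \<le> ennreal (sqrt (2 * pi) * exp (R\<^sup>2 / 2)) * (\<integral>\<^sup>+p. F p \<partial>?W)"
  proof -
    have "(\<integral>\<^sup>+p. F p \<partial>square R) = (\<integral>\<^sup>+x. \<integral>\<^sup>+y. F (x,y) \<partial>interval_measure_on R \<partial>interval_measure_on R)"
      unfolding square_def by (rule U.nn_integral_fst[symmetric]) measurable
    also have "\<dots> \<le> ennreal (sqrt (2 * pi) * exp (R\<^sup>2 / 2)) * (\<integral>\<^sup>+x. \<integral>\<^sup>+y. F (x,y) \<partial>interval_measure_on R \<partial>std_normal_distribution)"
      by (rule nn_integral_interval_le_normal) measurable
    also have "(\<integral>\<^sup>+x. \<integral>\<^sup>+y. F (x,y) \<partial>interval_measure_on R \<partial>std_normal_distribution) = (\<integral>\<^sup>+p. F p \<partial>?W)"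
      by (rule U.nn_integral_fst) measurable
    finally show ?thesis .
  qed
  ultimately show ?thesis
    unfolding F_def e_def by (meson mult_left_mono order_trans zero_le)
qed

text \<open>This is the Fourier extension operator of the parabola \<open>(t^2, t)\<close>,
  evaluated at \<open>lam\<close> times \<open>(x, y^2)\<close>.\<close>

definition extension :: "real \<Rightarrow> (real \<Rightarrow> complex) \<Rightarrow> real \<times> real \<Rightarrow> complex" where
  "extension lam g p = (LINT t|lborel. cis (lam * (fst p * t\<^sup>2 + (snd p)\<^sup>2 * t)) * g t)"

text \<open>The powers \<open>^ 2\<close> and \<open>^ 1\<close> are the case \<open>k = 1\<close>
  of the shape \<open>2 * k\<close> and \<open>k\<close> that the removal of the amplitude
  expects.\<close>

lemma extension_L2_bound:
  assumes lam: "lam > 0" and g: "integrable lborel g"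
  shows "(\<integral>\<^sup>+p. ennreal ((norm (extension lam g p)) ^ 2) \<partial>square R)
    \<le> ennreal (sqrt (2 * pi) * exp (R\<^sup>2 / 2) * (16 * pi * (1 + 4 * pi)) * lam powr (-3/4))
      * (\<integral>\<^sup>+t. ennreal ((norm (g t))\<^sup>2) \<partial>lborel) ^ 1"
proof -
  have "(\<integral>\<^sup>+p. ennreal ((norm (extension lam g p)) ^ 2) \<partial>square R)
     \<le> ennreal (sqrt (2 * pi) * exp (R\<^sup>2 / 2)) *
        (ennreal (16 * pi * (1 + 4 * pi) * lam powr (-3/4)) * (\<integral>\<^sup>+t. ennreal ((norm (g t))\<^sup>2) \<partial>lborel))"
    unfolding extension_def
    by (rule extension_L2[where A=UNIV and a="\<lambda>t. t\<^sup>2" and b="\<lambda>t. t"])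
       (use g schur_kernel_line[OF lam] in \<open>auto intro: lborel.sigma_finite_measure_axioms\<close>)
  also have "\<dots> = ennreal (sqrt (2 * pi) * exp (R\<^sup>2 / 2) * (16 * pi * (1 + 4 * pi) * lam powr (-3/4)))
      * (\<integral>\<^sup>+t. ennreal ((norm (g t))\<^sup>2) \<partial>lborel)"
    by (subst (3) ennreal_mult) (auto simp: mult_ac)
  finally show ?thesis by (simp add: mult.assoc)
qed

text \<open>The sixth power of the modulus is the square of the modulus of the cube, and the cube is
  the three-variable operator applied to the tensor cube \<open>G\<close> of \<open>g\<close>. The
  squared L2 norm of \<open>G\<close> is the third power of that of \<open>g\<close>.\<close>

lemma extension_L6_bound:
  assumes lam: "lam > 0" and R: "R > 0" and g: "integrable lborel g" and supp: "\<And>t. \<bar>t\<bar> > R \<Longrightarrow> g t = 0"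
  shows "(\<integral>\<^sup>+p. ennreal ((norm (extension lam g p)) ^ 6) \<partial>square R)
    \<le> ennreal (sqrt (2 * pi) * exp (R\<^sup>2 / 2) * (8 * pi\<^sup>2 * (1 + 4 * pi) * sqrt (7 * R)) * lam powr (-3/2))
      * (\<integral>\<^sup>+t. ennreal ((norm (g t))\<^sup>2) \<partial>lborel) ^ 3"
proof -
  let ?L2 = "lborel \<Otimes>\<^sub>M lborel :: (real \<times> real) measure"
  let ?L3 = "lborel \<Otimes>\<^sub>M ?L2 :: (real \<times> real \<times> real) measure"
  interpret L2: sigma_finite_measure ?L2 by (rule lborel_pair.P.sigma_finite_measure_axioms)
  interpret LL: pair_sigma_finite "lborel :: real measure" ?L2 ..
  have [measurable]: "g \<in> borel_measurable borel" using borel_measurable_integrable[OF g] by simp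
  define G where "G m = g (fst m) * (g (fst (snd m)) * g (snd (snd m)))" for m
  define a :: "real \<times> real \<times> real \<Rightarrow> real" where "a m = (fst m)\<^sup>2 + (fst (snd m))\<^sup>2 + (snd (snd m))\<^sup>2" for m
  define b :: "real \<times> real \<times> real \<Rightarrow> real" where "b m = fst m + fst (snd m) + snd (snd m)" for m
  \<comment> \<open>This cube contains the support of \<open>G\<close>; on it the sum
    \<open>b\<close> is at most \<open>3 * R\<close> in size, as the Schur bound in three variables
    requires.\<close>
  define A where "A = {-R..R} \<times> {-R..R} \<times> {-R..R}"
  have am [measurable]: "a \<in> borel_measurable ?L3" "b \<in> borel_measurable ?L3" unfolding a_def b_def by measurable
  have A [measurable]: "A \<in> sets ?L3" unfolding A_def by measurable
  have Gi: "integrable ?L3 G"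
    unfolding G_def using LL.integrable_fst_times_snd[OF g lborel_pair.integrable_fst_times_snd[OF g g]] .
  have [measurable]: "G \<in> borel_measurable ?L3" using Gi by simp
  have cube: "(LINT m|?L3. cis (lam * (fst p * a m + (snd p)\<^sup>2 * b m)) * G m) = extension lam g p ^ 3" for p
  proof -
    let ?h = "\<lambda>t. cis (lam * (fst p * t\<^sup>2 + (snd p)\<^sup>2 * t)) * g t"
    have h: "integrable lborel ?h"
      by (rule Bochner_Integration.integrable_bound[OF g]) (auto simp: norm_mult)
    have "(LINT m|?L3. cis (lam * (fst p * a m + (snd p)\<^sup>2 * b m)) * G m)
       = (LINT m|?L3. ?h (fst m) * (?h (fst (snd m)) * ?h (snd (snd m))))"
      by (intro Bochner_Integration.integral_cong refl)
         (simp add: G_def a_def b_def cis_mult[symmetric] distrib_left distrib_right mult_ac)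
    also have "\<dots> = (LINT t|lborel. ?h t) * (LINT q|?L2. ?h (fst q) * ?h (snd q))"
      by (rule LL.integral_fst_times_snd[OF h lborel_pair.integrable_fst_times_snd[OF h h]])
    also have "(LINT q|?L2. ?h (fst q) * ?h (snd q)) = (LINT t|lborel. ?h t) * (LINT t|lborel. ?h t)"
      by (rule lborel_pair.integral_fst_times_snd[OF h h])
    finally show ?thesis by (simp add: extension_def power3_eq_cube)
  qed
  have split: "(\<integral>\<^sup>+m. F m \<partial>?L3) = (\<integral>\<^sup>+s1. \<integral>\<^sup>+s2. \<integral>\<^sup>+s3. F (s1,s2,s3) \<partial>lborel \<partial>lborel \<partial>lborel)"
    if [measurable]: "F \<in> borel_measurable ?L3" for F
  proof -
    have "(\<integral>\<^sup>+s2. \<integral>\<^sup>+s3. F (s1,s2,s3) \<partial>lborel \<partial>lborel) = (\<integral>\<^sup>+q. F (s1,q) \<partial>?L2)" for s1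
      by (subst lborel.nn_integral_fst[symmetric]) auto
    then show ?thesis by (subst lborel_pair.P.nn_integral_fst[symmetric]) auto
  qed
  have G2: "(\<integral>\<^sup>+m. ennreal ((norm (G m))\<^sup>2) \<partial>?L3) = (\<integral>\<^sup>+t. ennreal ((norm (g t))\<^sup>2) \<partial>lborel) ^ 3"
    by (subst split)
       (auto simp: G_def norm_mult power_mult_distrib ennreal_mult nn_integral_cmult nn_integral_multc power3_eq_cube mult_ac)
  have "(\<integral>\<^sup>+p. ennreal ((norm (LINT m|?L3. cis (lam * (fst p * a m + (snd p)\<^sup>2 * b m)) * G m))\<^sup>2) \<partial>square R)
     \<le> ennreal (sqrt (2 * pi) * exp (R\<^sup>2 / 2)) *
        (ennreal (8 * pi\<^sup>2 * (1 + 4 * pi) * sqrt (7 * R) * lam powr (-3/2)) * (\<integral>\<^sup>+m. ennreal ((norm (G m))\<^sup>2) \<partial>?L3))"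
  proof (rule extension_L2[OF LL.P.sigma_finite_measure_axioms am Gi A])
    show "G m = 0" if "m \<notin> A" for m
      using that supp by (cases m) (auto simp: A_def G_def not_le abs_if)
    fix m assume m: "m \<in> A"
    have "\<bar>b m\<bar> \<le> 3 * R" using m by (auto simp: A_def b_def abs_le_iff)
    from schur_kernel_space[OF lam R this, of "a m"]
    show "(\<integral>\<^sup>+m'. ennreal (exp (- ((lam * (a m - a m'))\<^sup>2) / 2) * norm (fresnel R (lam * (b m - b m')))) * indicator A m' \<partial>?L3)
       \<le> ennreal (8 * pi\<^sup>2 * (1 + 4 * pi) * sqrt (7 * R) * lam powr (-3/2))"
      by (subst split) (auto simp: a_def b_def A_def indicator_times mult_ac)
  qed
  also have "\<dots> = ennreal (sqrt (2 * pi) * exp (R\<^sup>2 / 2) * (8 * pi\<^sup>2 * (1 + 4 * pi) * sqrt (7 * R) * lam powr (-3/2)))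
      * (\<integral>\<^sup>+t. ennreal ((norm (g t))\<^sup>2) \<partial>lborel) ^ 3"
    unfolding G2 using R by (subst (3) ennreal_mult) (auto simp: mult_ac)
  finally show ?thesis
    unfolding cube by (simp add: norm_power power_mult[symmetric] mult.assoc)
qed

section \<open>Removing the amplitude\<close>

text \<open>Bernoulli's inequality applied to \<open>u / c\<close>: the tangent of the convex
  function \<open>u^n\<close> at \<open>c\<close> lies below its graph.\<close>

lemma power_ge_tangent:
  fixes c u :: real
  assumes "c > 0" "u \<ge> 0" "n \<ge> 1"
  shows "c ^ n + real n * c ^ (n - 1) * (u - c) \<le> u ^ n"
proof -
  have "1 + real n * (u / c - 1) \<le> (1 + (u / c - 1)) ^ n"
    using assms by (intro Bernoulli_inequality) simp
  then have "c ^ n * (1 + real n * (u / c - 1)) \<le> c ^ n * (u / c) ^ n"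
    using assms by (intro mult_left_mono) auto
  moreover have "c ^ n * (u / c) ^ n = u ^ n"
    using assms by (simp add: power_divide)
  moreover have "c ^ n * (1 + real n * (u / c - 1)) = c ^ n + real n * c ^ (n - 1) * (u - c)"
    using assms by (cases n) (auto simp: field_simps)
  ultimately show ?thesis by simp
qed

text \<open>Jensen's inequality, proved by integrating the tangent at the mean value. It lets an
  average over quadrants pass through an L2 or L6 norm, in place of Minkowski's integral
  inequality.\<close>

lemma (in finite_measure) power_integral_le:
  fixes F :: "'a \<Rightarrow> real"
  assumes [measurable]: "F \<in> borel_measurable M" and F: "\<And>x. 0 \<le> F x" "\<And>x. F x \<le> B" and n: "n \<ge> 1"
  shows "(LINT x|M. F x) ^ n \<le> measure M (space M) ^ (n - 1) * (LINT x|M. F x ^ n)"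
proof -
  define \<mu> where "\<mu> = measure M (space M)"
  define I where "I = (LINT x|M. F x)"
  have I0: "I \<ge> 0" using F by (simp add: I_def)
  have iF: "integrable M F" by (rule integrable_const_bound[where B=B]) (use F in auto)
  have iFn: "integrable M (\<lambda>x. F x ^ n)"
    by (rule integrable_const_bound[where B="B ^ n"]) (use F in \<open>auto intro!: power_mono\<close>)
  have J0: "0 \<le> (LINT x|M. F x ^ n)" using F by simp
  show ?thesis
  \<comment> \<open>A vanishing integral is separated because the point of tangency must be
    positive; otherwise the total mass is positive and the mean makes sense.\<close>
  proof (cases "I = 0")
    case True
    then show ?thesis using n J0 by (cases n) (auto simp: I_def)
  next
    case False
    have "\<mu> \<noteq> 0"
    proof
      assume "\<mu> = 0"
      then have "emeasure M (space M) = 0" by (simp add: \<mu>_def emeasure_eq_measure)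
      then have "AE x in M. F x = 0" by (auto intro!: AE_I'[of "space M"] simp: null_sets_def)
      then have "I = 0" unfolding I_def by (simp add: integral_eq_zero_AE)
      then show False using False by simp
    qed
    then have \<mu>: "\<mu> > 0" by (simp add: \<mu>_def zero_less_measure_iff measure_nonneg less_le)
    define c where "c = I / \<mu>"
    have c: "c > 0" using I0 False \<mu> by (simp add: c_def)
    have "(LINT x|M. c ^ n + real n * c ^ (n - 1) * (F x - c)) \<le> (LINT x|M. F x ^ n)"
      by (intro integral_mono iFn power_ge_tangent c F n) (use iF in auto)
    also have "(LINT x|M. c ^ n + real n * c ^ (n - 1) * (F x - c)) = \<mu> * c ^ n + real n * c ^ (n - 1) * (I - \<mu> * c)"
      using iF by (simp add: I_def \<mu>_def)
    also have "I - \<mu> * c = 0" using \<mu> by (simp add: c_def)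
    finally have "\<mu> * c ^ n \<le> (LINT x|M. F x ^ n)" by simp
    then have "\<mu> ^ (n - 1) * (\<mu> * c ^ n) \<le> \<mu> ^ (n - 1) * (LINT x|M. F x ^ n)"
      using \<mu> by (intro mult_left_mono) auto
    moreover have "\<mu> ^ (n - 1) * (\<mu> * c ^ n) = I ^ n"
      using n \<mu> by (cases n) (auto simp: c_def power_divide field_simps)
    ultimately show ?thesis by (simp add: I_def \<mu>_def)
  qed
qed

section \<open>Smooth functions and the quadrant representation of the amplitude\<close>

lemma smooth_differentiable: "smooth f \<Longrightarrow> f differentiable (at x)"
  by (erule smooth.cases) auto

lemma smooth_frechet_derivative: "smooth f \<Longrightarrow> smooth (\<lambda>x. frechet_derivative f (at x) v)"
  by (erule smooth.cases) auto

lemma smooth_continuous_on: "smooth f \<Longrightarrow> continuous_on S f"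
  by (meson continuous_at_imp_continuous_on differentiable_imp_continuous_within smooth_differentiable)

lemma frechet_derivative_zero_outside:
  assumes "closed S" "\<And>p. p \<notin> S \<Longrightarrow> f p = 0" "p \<notin> S"
  shows "frechet_derivative f (at p) v = 0"
proof -
  have "(f has_derivative (\<lambda>_. 0)) (at p)"
    by (rule has_derivative_transform_within_open[where f="\<lambda>_. 0" and s="-S"]) (use assms in auto)
  then show ?thesis by (simp add: frechet_derivative_at[symmetric])
qed

lemma has_vector_derivative_frechet_line:
  fixes f :: "'a::real_normed_vector \<Rightarrow> 'b::real_normed_vector"
  assumes "f differentiable (at (g s))" "(g has_vector_derivative v) (at s)"
  shows "((\<lambda>s. f (g s)) has_vector_derivative frechet_derivative f (at (g s)) v) (at s)"
proof -
  have f: "(f has_derivative frechet_derivative f (at (g s))) (at (g s))"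
    using assms(1) frechet_derivative_works by blast
  have "((\<lambda>s. f (g s)) has_derivative (\<lambda>h. frechet_derivative f (at (g s)) (h *\<^sub>R v))) (at s)"
    using has_derivative_compose[OF assms(2)[unfolded has_vector_derivative_def] f] .
  then show ?thesis
    unfolding has_vector_derivative_def
    by (simp add: linear_cmul[OF has_derivative_linear[OF f]])
qed

lemma integral_derivative_vanishing_at_right:
  fixes F :: "real \<Rightarrow> complex"
  assumes x: "-R \<le> x" "x \<le> R" and D: "\<And>s. (F has_vector_derivative F' s) (at s)" and F': "continuous_on UNIV F'" and "F R = 0"
  shows "(LINT s:{-R..R}|lborel. indicator {x..} s * F' s) = - F x"
proof -
  have c: "continuous_on {x..R} F'" using F' continuous_on_subset by blast
  have "(LINT s:{-R..R}|lborel. indicator {x..} s * F' s) = (LINT s:{x..R}|lborel. F' s)"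
    unfolding set_lebesgue_integral_def
    by (intro Bochner_Integration.integral_cong refl) (use x in \<open>auto simp: indicator_def\<close>)
  also have "\<dots> = integral {x..R} F'"
    by (intro set_borel_integral_eq_integral borel_integrable_atLeastAtMost' c)
  also have "\<dots> = F R - F x"
    by (intro integral_unique fundamental_theorem_of_calculus assms has_vector_derivative_at_within D)
  finally show ?thesis using assms by simp
qed

text \<open>The fundamental theorem of calculus is used from the right edge of the interval in each
  variable, so two minus signs occur and cancel. The position (x, y) survives only in the
  indicators, which do not involve \<open>t\<close>.\<close>

lemma Cc_inf_integral_representation:
  fixes \<psi> :: "real \<times> real \<times> real \<Rightarrow> complex"
  assumes "Cc_inf \<psi>"
  obtains R M \<Psi> where "R > 0" "M > 0" "\<Psi> \<in> borel_measurable borel" "\<And>p. norm (\<Psi> p) \<le> M"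
    "\<And>x y t. \<bar>t\<bar> > R \<Longrightarrow> \<Psi> (x,y,t) = 0"
    "\<And>x y t. \<not> (\<bar>x\<bar> \<le> R \<and> \<bar>y\<bar> \<le> R) \<Longrightarrow> \<psi> (x,y,t) = 0"
    "\<And>x y t. \<bar>x\<bar> \<le> R \<Longrightarrow> \<bar>y\<bar> \<le> R \<Longrightarrow>
       \<psi> (x,y,t) = (LINT q|square R. indicator {x..} (fst q) * indicator {y..} (snd q) * \<Psi> (fst q, snd q, t))"
proof -
  have sm: "smooth \<psi>" and cs: "compact (closure {p. \<psi> p \<noteq> 0})"
    using assms by (auto simp: Cc_inf_def compact_support_def)
  define S where "S = closure {p. \<psi> p \<noteq> 0}"
  have S: "closed S" "compact S" using cs by (auto simp: S_def)
  have \<psi>0: "\<psi> p = 0" if "p \<notin> S" for p using that closure_subset[of "{p. \<psi> p \<noteq> 0}"] by (auto simp: S_def)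
  define D where "D p = frechet_derivative \<psi> (at p) (1,0,0)" for p
  \<comment> \<open>The mixed derivative, first in \<open>x\<close> and then in \<open>y\<close>;
    both steps stay within the smooth functions and do not enlarge the support.\<close>
  define \<Psi> where "\<Psi> p = frechet_derivative D (at p) (0,1,0)" for p
  have smD: "smooth D" unfolding D_def using smooth_frechet_derivative[OF sm] .
  have sm\<Psi>: "smooth \<Psi>" unfolding \<Psi>_def using smooth_frechet_derivative[OF smD] .
  have D0: "D p = 0" if "p \<notin> S" for p
    unfolding D_def by (rule frechet_derivative_zero_outside[OF S(1) \<psi>0 that])
  have \<Psi>0: "\<Psi> p = 0" if "p \<notin> S" for p
    unfolding \<Psi>_def by (rule frechet_derivative_zero_outside[OF S(1) D0 that])
  obtain R0 where R0: "R0 > 0" "\<And>p. p \<in> S \<Longrightarrow> norm p \<le> R0"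
    using compact_imp_bounded[OF S(2)] unfolding bounded_pos by blast
  \<comment> \<open>The extra 1 puts the boundary value \<open>R\<close> itself strictly outside the
    support, so the boundary terms at the right edge vanish.\<close>
  define R where "R = R0 + 1"
  have out: "(x,y,t) \<notin> S" if "\<bar>x\<bar> \<ge> R \<or> \<bar>y\<bar> \<ge> R \<or> \<bar>t\<bar> \<ge> R" for x y t
  proof
    assume "(x,y,t) \<in> S"
    then have "norm (x,y,t) \<le> R0" by (rule R0)
    moreover have "\<bar>x\<bar> \<le> norm (x,y,t)" "\<bar>y\<bar> \<le> norm (x,y,t)" "\<bar>t\<bar> \<le> norm (x,y,t)"
      by (metis norm_fst_le norm_snd_le order_trans real_norm_def)+
    ultimately show False using that R0(1) by (auto simp: R_def)
  qed
  have c\<Psi>: "continuous_on UNIV \<Psi>" and cD: "continuous_on UNIV D"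
    using smooth_continuous_on sm\<Psi> smD by auto
  obtain M where M: "M > 0" "\<And>p. norm (\<Psi> p) \<le> M"
  proof -
    have "bounded (\<Psi> ` S)"
      by (intro compact_imp_bounded compact_continuous_image S continuous_on_subset[OF c\<Psi>]) auto
    then obtain M where "M > 0" "\<And>p. p \<in> S \<Longrightarrow> norm (\<Psi> p) \<le> M" unfolding bounded_pos by auto
    then have "norm (\<Psi> p) \<le> M" for p using \<Psi>0[of p] by (cases "p \<in> S") auto
    then show ?thesis using that \<open>M > 0\<close> by blast
  qed
  have m\<Psi> [measurable]: "\<Psi> \<in> borel_measurable borel" using c\<Psi> by (rule borel_measurable_continuous_onI)
  have mD [measurable]: "D \<in> borel_measurable borel" using cD by (rule borel_measurable_continuous_onI)
  have rep: "\<psi> (x,y,t) = (LINT q|square R. indicator {x..} (fst q) * indicator {y..} (snd q) * \<Psi> (fst q, snd q, t))"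
    if x: "\<bar>x\<bar> \<le> R" and y: "\<bar>y\<bar> \<le> R" for x y t
  proof -
    interpret U: finite_measure "interval_measure_on R" by (rule finite_measure_interval_measure_on)
    interpret UU: pair_sigma_finite "interval_measure_on R" "interval_measure_on R" ..
    interpret B: finite_measure "interval_measure_on R \<Otimes>\<^sub>M interval_measure_on R"
      by (rule finite_measure_pair_measure) unfold_locales
    let ?h = "\<lambda>q. indicator {x..} (fst q) * indicator {y..} (snd q) * \<Psi> (fst q, snd q, t)"
    have hm: "?h \<in> borel_measurable (interval_measure_on R \<Otimes>\<^sub>M interval_measure_on R)" by measurable
    have hi: "integrable (interval_measure_on R \<Otimes>\<^sub>M interval_measure_on R) ?h"
      by (rule B.integrable_const_bound[where B=M]) (use hm M in \<open>auto simp: norm_mult indicator_def less_imp_le\<close>)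
    have inner: "(LINT b|interval_measure_on R. indicator {y..} b * \<Psi> (a, b, t)) = - D (a,y,t)" for a
    proof -
      have "((\<lambda>b. D (a,b,t)) has_vector_derivative \<Psi> (a,b,t)) (at b)" for b
        unfolding \<Psi>_def
        by (rule has_vector_derivative_frechet_line[of D "\<lambda>b. (a,b,t)"])
           (auto intro!: smooth_differentiable[OF smD] derivative_eq_intros simp: has_vector_derivative_def zero_prod_def)
      note d = this
      have "(LINT b:{-R..R}|lborel. indicator {y..} b * \<Psi> (a,b,t)) = - D (a,y,t)"
      proof (rule integral_derivative_vanishing_at_right[where F="\<lambda>b. D (a,b,t)" and x=y, OF _ _ d])
        show "continuous_on UNIV (\<lambda>b. \<Psi> (a,b,t))"
          by (rule continuous_on_compose2[OF c\<Psi>]) (auto intro!: continuous_intros)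
        show "D (a,R,t) = 0" by (intro D0 out) auto
      qed (use y in auto)
      then show ?thesis by (subst integral_interval_measure_on) auto
    qed
    have outer: "(LINT a|interval_measure_on R. indicator {x..} a * D (a,y,t)) = - \<psi> (x,y,t)"
    proof -
      have "((\<lambda>a. \<psi> (a,y,t)) has_vector_derivative D (a,y,t)) (at a)" for a
        unfolding D_def
        by (rule has_vector_derivative_frechet_line[of \<psi> "\<lambda>a. (a,y,t)"])
           (auto intro!: smooth_differentiable[OF sm] derivative_eq_intros simp: has_vector_derivative_def zero_prod_def)
      note d = this
      have "(LINT a:{-R..R}|lborel. indicator {x..} a * D (a,y,t)) = - \<psi> (x,y,t)"
      proof (rule integral_derivative_vanishing_at_right[where F="\<lambda>a. \<psi> (a,y,t)" and x=x, OF _ _ d])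
        show "continuous_on UNIV (\<lambda>a. D (a,y,t))"
          by (rule continuous_on_compose2[OF cD]) (auto intro!: continuous_intros)
        show "\<psi> (R,y,t) = 0" by (intro \<psi>0 out) auto
      qed (use x in auto)
      then show ?thesis by (subst integral_interval_measure_on) auto
    qed
    have "(LINT q|square R. ?h q) = (LINT a|interval_measure_on R. LINT b|interval_measure_on R. ?h (a,b))"
      unfolding square_def by (rule UU.integral_fst'[OF hi, symmetric])
    also have "\<dots> = (LINT a|interval_measure_on R. indicator {x..} a * (LINT b|interval_measure_on R. indicator {y..} b * \<Psi> (a, b, t)))"
      by (simp add: mult.assoc)
    also have "\<dots> = \<psi> (x,y,t)" unfolding inner using outer by simp
    finally show ?thesis by simp
  qed
  show ?thesis
  proof (rule that[OF _ M(1) m\<Psi> M(2)])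
    show "R > 0" using R0 by (simp add: R_def)
    show "\<Psi> (x,y,t) = 0" if "\<bar>t\<bar> > R" for x y t using that by (intro \<Psi>0 out) auto
    show "\<psi> (x,y,t) = 0" if "\<not> (\<bar>x\<bar> \<le> R \<and> \<bar>y\<bar> \<le> R)" for x y t using that by (intro \<psi>0 out) auto
  qed (use rep in auto)
qed

section \<open>Transfer of the amplitude-free bounds to \<open>osc_op\<close>\<close>

lemma finite_measure_square: "finite_measure (square R)"
proof -
  interpret U: finite_measure "interval_measure_on R" by (rule finite_measure_interval_measure_on)
  show ?thesis unfolding square_def by (rule finite_measure_pair_measure) unfold_locales
qed

lemma sets_square [measurable_cong, simp]: "sets (square R) = sets (borel \<Otimes>\<^sub>M borel)"
  unfolding square_def by (intro sets_pair_measure_cong) auto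

lemma nn_integral_lborel_eq_square:
  fixes F :: "real \<times> real \<Rightarrow> ennreal"
  assumes [measurable]: "F \<in> borel_measurable borel"
    and F0: "\<And>x y. \<not> (\<bar>x\<bar> \<le> R \<and> \<bar>y\<bar> \<le> R) \<Longrightarrow> F (x,y) = 0"
  shows "(\<integral>\<^sup>+p. F p \<partial>lborel) = (\<integral>\<^sup>+p. F p \<partial>square R)"
proof -
  interpret U: finite_measure "interval_measure_on R" by (rule finite_measure_interval_measure_on)
  have Fm [measurable]: "F \<in> borel_measurable (borel \<Otimes>\<^sub>M borel)" by (simp add: borel_prod)
  have 1: "F (x,y) * indicator {-R..R} y = F (x,y)" for x y using F0[of x y] by (auto simp: indicator_def)
  have 2: "(\<integral>\<^sup>+y. F (x,y) \<partial>lborel) * indicator {-R..R} x = (\<integral>\<^sup>+y. F (x,y) \<partial>lborel)" for x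
    using F0[of x] by (auto simp: indicator_def abs_le_iff)
  have "(\<integral>\<^sup>+p. F p \<partial>square R) = (\<integral>\<^sup>+x. \<integral>\<^sup>+y. F (x,y) \<partial>interval_measure_on R \<partial>interval_measure_on R)"
    unfolding square_def by (rule U.nn_integral_fst[symmetric]) measurable
  also have "\<dots> = (\<integral>\<^sup>+x. \<integral>\<^sup>+y. F (x,y) \<partial>lborel \<partial>lborel)"
    by (simp add: nn_integral_interval_measure_on 1 2)
  also have "\<dots> = (\<integral>\<^sup>+p. F p \<partial>lborel)"
    by (subst lborel_prod[symmetric], rule lborel.nn_integral_fst) measurable
  finally show ?thesis by simp
qed

lemma borel_measurable_osc_op:
  assumes [measurable]: "\<psi> \<in> borel_measurable borel" "f \<in> borel_measurable borel"
  shows "osc_op \<psi> lam f \<in> borel_measurable borel"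
proof -
  have "(\<lambda>p. LINT t|lborel. exp (\<i> * complex_of_real (lam * (fst p * t\<^sup>2 + (snd p)\<^sup>2 * t))) * \<psi> (fst p, snd p, t) * f t)
      \<in> borel_measurable (borel \<Otimes>\<^sub>M borel)"
    unfolding cis_conv_exp[symmetric] by measurable
  also have "(\<lambda>p. LINT t|lborel. exp (\<i> * complex_of_real (lam * (fst p * t\<^sup>2 + (snd p)\<^sup>2 * t))) * \<psi> (fst p, snd p, t) * f t) = osc_op \<psi> lam f"
    by (auto simp: osc_op_def fun_eq_iff)
  finally show ?thesis by (simp add: borel_prod)
qed

text \<open>For a fixed corner \<open>q\<close> the weight \<open>\<Psi>\<close> depends only on
  \<open>t\<close> and is absorbed into \<open>f\<close>, giving \<open>g q\<close>. After Fubini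
  the operator is an average over \<open>q\<close> of an indicator times the extension of
  \<open>g q\<close>; the assumption \<open>ext\<close> applies to each \<open>g q\<close>
  separately.\<close>

lemma osc_op_nn_integral_bound:
  fixes \<psi> :: "real \<times> real \<times> real \<Rightarrow> complex"
  assumes R: "R > 0" and M: "M > 0" and \<Psi> [measurable]: "\<Psi> \<in> borel_measurable borel"
    and \<Psi>M: "\<And>p. norm (\<Psi> p) \<le> M"
    and \<Psi>supp: "\<And>x y t. \<bar>t\<bar> > R \<Longrightarrow> \<Psi> (x,y,t) = 0"
    and \<psi> [measurable]: "\<psi> \<in> borel_measurable borel"
    and \<psi>supp: "\<And>x y t. \<not> (\<bar>x\<bar> \<le> R \<and> \<bar>y\<bar> \<le> R) \<Longrightarrow> \<psi> (x,y,t) = 0"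
    and rep: "\<And>x y t. \<bar>x\<bar> \<le> R \<Longrightarrow> \<bar>y\<bar> \<le> R \<Longrightarrow>
       \<psi> (x,y,t) = (LINT q|square R. indicator {x..} (fst q) * indicator {y..} (snd q) * \<Psi> (fst q, snd q, t))"
    and K: "K \<ge> 0" and k: "k \<ge> 1"
    and ext: "\<And>g. integrable lborel g \<Longrightarrow> (\<And>t. \<bar>t\<bar> > R \<Longrightarrow> g t = 0) \<Longrightarrow>
      (\<integral>\<^sup>+p. ennreal (norm (extension lam g p) ^ (2 * k)) \<partial>square R)
        \<le> ennreal K * (\<integral>\<^sup>+t. ennreal ((norm (g t))\<^sup>2) \<partial>lborel) ^ k"
    and f [measurable]: "f \<in> borel_measurable borel" and f2: "integrable lborel (\<lambda>t. (norm (f t))\<^sup>2)"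
  shows "(\<integral>\<^sup>+p. ennreal (norm (osc_op \<psi> lam f p) ^ (2 * k)) \<partial>lborel)
     \<le> ennreal ((measure (square R) (space (square R)) * M) ^ (2 * k) * K * (LINT t|lborel. (norm (f t))\<^sup>2) ^ k)"
proof -
  interpret B: finite_measure "square R" by (rule finite_measure_square)
  interpret BL: pair_sigma_finite "square R" "lborel :: real measure" ..
  define \<mu> where "\<mu> = measure (square R) (space (square R))"
  define I where "I = (LINT t|lborel. (norm (f t))\<^sup>2)"
  define g where "g q t = \<Psi> (fst q, snd q, t) * f t" for q t
  define m where "m t = M * (norm (f t) * indicator {-R..R} t)" for t
  have gm [measurable]: "(\<lambda>(q,t). g q t) \<in> borel_measurable ((borel \<Otimes>\<^sub>M borel) \<Otimes>\<^sub>M borel)"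
    unfolding g_def by measurable
  have gm': "g q \<in> borel_measurable borel" for q
    unfolding g_def by measurable
  have mm [measurable]: "m \<in> borel_measurable borel" unfolding m_def by measurable
  have gsupp: "g q t = 0" if "\<bar>t\<bar> > R" for q t using \<Psi>supp[OF that] by (simp add: g_def)
  have gle: "norm (g q t) \<le> m t" for q t
  proof (cases "\<bar>t\<bar> > R")
    case False
    then have "t \<in> {-R..R}" by auto
    then show ?thesis using mult_right_mono[OF \<Psi>M, of "norm (f t)" "(fst q, snd q, t)"]
      by (simp add: g_def m_def norm_mult)
  qed (use gsupp M in \<open>auto simp: m_def\<close>)
  \<comment> \<open>A square integrable \<open>f\<close> is integrable on the bounded interval
    because its modulus is at most one plus its square there. This makes every extension of
    \<open>g q\<close> an absolutely convergent integral.\<close>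
  have mi: "integrable lborel m"
  proof -
    have "integrable lborel (\<lambda>t. M * (indicator {-R..R} t + (norm (f t))\<^sup>2))"
      by (intro integrable_mult_right Bochner_Integration.integrable_add f2 integrable_real_indicator) (auto simp: emeasure_lborel_Icc_eq)
    then show ?thesis
    proof (rule Bochner_Integration.integrable_bound)
      have "m t \<le> M * (indicator {-R..R} t + (norm (f t))\<^sup>2)" for t
      proof -
        have "norm (f t) \<le> 2 * 1 * norm (f t)" by simp
        also have "\<dots> \<le> 1\<^sup>2 + (norm (f t))\<^sup>2" by (rule sum_squares_bound)
        finally have "norm (f t) \<le> 1 + (norm (f t))\<^sup>2" by simp
        then show ?thesis unfolding m_def using M
          by (intro mult_left_mono) (auto simp: indicator_def)
      qed
      then show "AE t in lborel. norm (m t) \<le> norm (M * (indicator {-R..R} t + (norm (f t))\<^sup>2))"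
        using M by (auto simp: m_def)
    qed (use mm in simp)
  qed
  have gi: "integrable lborel (g q)" for q
    by (rule Bochner_Integration.integrable_bound[OF mi]) (use gm' gle[of q] in \<open>auto intro!: AE_I2 order_trans[OF gle abs_ge_self]\<close>)
  define X where "X q p = norm (extension lam (g q) p)" for q p
  have Xm [measurable]: "(\<lambda>(q,p). X q p) \<in> borel_measurable ((borel \<Otimes>\<^sub>M borel) \<Otimes>\<^sub>M (borel \<Otimes>\<^sub>M borel))"
    unfolding X_def extension_def g_def by measurable
  have X0: "0 \<le> X q p" for q p by (simp add: X_def)
  have Xle: "X q p \<le> (LINT t|lborel. m t)" for q p
  proof -
    have "X q p \<le> (LINT t|lborel. norm (cis (lam * (fst p * t\<^sup>2 + (snd p)\<^sup>2 * t)) * g q t))"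
      unfolding X_def extension_def by (rule integral_norm_bound)
    also have "\<dots> = (LINT t|lborel. norm (g q t))" by (simp add: norm_mult)
    also have "\<dots> \<le> (LINT t|lborel. m t)" by (intro integral_mono integrable_norm gi mi gle)
    finally show ?thesis .
  qed
  have osc: "norm (osc_op \<psi> lam f (x,y)) \<le> (LINT q|square R. X q (x,y))" if xy: "\<bar>x\<bar> \<le> R" "\<bar>y\<bar> \<le> R" for x y
  proof -
    define h :: "real \<times> real \<Rightarrow> complex" where "h q = indicator {x..} (fst q) * indicator {y..} (snd q)" for q
    have hm [measurable]: "h \<in> borel_measurable (borel \<Otimes>\<^sub>M borel)" unfolding h_def by measurable
    have h1: "norm (h q) \<le> 1" for q by (auto simp: h_def norm_mult indicator_def)
    define c where "c t = cis (lam * (x * t\<^sup>2 + y\<^sup>2 * t))" for t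
    have cm [measurable]: "c \<in> borel_measurable borel" unfolding c_def by measurable
    \<comment> \<open>The square has finite measure, so the constant 1 in \<open>q\<close> times
      \<open>m\<close> in \<open>t\<close> is an integrable dominating function for Fubini.\<close>
    have "integrable (square R \<Otimes>\<^sub>M lborel) (\<lambda>p. (\<lambda>_. 1 :: complex) (fst p) * (\<lambda>t. of_real (m t)) (snd p))"
      by (rule BL.integrable_fst_times_snd) (use mi in auto)
    then have Hi: "integrable (square R \<Otimes>\<^sub>M lborel) (\<lambda>(q,t). h q * (c t * g q t))"
    proof (rule Bochner_Integration.integrable_bound)
      show "AE p in square R \<Otimes>\<^sub>M lborel. norm (case p of (q, t) \<Rightarrow> h q * (c t * g q t)) \<le> norm (1 * complex_of_real (m (snd p)))"
      proof (rule AE_I2)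
        fix p :: "(real \<times> real) \<times> real"
        obtain q t where p: "p = (q,t)" by (cases p)
        have "norm (h q) * norm (g q t) \<le> 1 * m t"
          by (intro mult_mono h1 gle) auto
        then show "norm (case p of (q, t) \<Rightarrow> h q * (c t * g q t)) \<le> norm (1 * complex_of_real (m (snd p)))"
          by (simp add: p norm_mult c_def)
      qed
    qed measurable
    have "osc_op \<psi> lam f (x,y) = (LINT t|lborel. LINT q|square R. h q * (c t * g q t))"
      unfolding osc_op_def prod.case
    proof (rule Bochner_Integration.integral_cong[OF refl])
      fix t :: real
      have "(LINT q|square R. h q * (c t * g q t)) = (LINT q|square R. (h q * \<Psi> (fst q, snd q, t)) * (c t * f t))"
        by (simp add: g_def mult_ac)
      also have "\<dots> = \<psi> (x,y,t) * (c t * f t)"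
        by (simp add: rep[OF xy] h_def)
      finally show "exp (\<i> * complex_of_real (lam * (x * t\<^sup>2 + y\<^sup>2 * t))) * \<psi> (x, y, t) * f t
         = (LINT q|square R. h q * (c t * g q t))"
        by (simp add: c_def cis_conv_exp mult_ac)
    qed
    also have "\<dots> = (LINT q|square R. LINT t|lborel. h q * (c t * g q t))"
      by (rule BL.Fubini_integral[OF Hi])
    also have "\<dots> = (LINT q|square R. h q * extension lam (g q) (x,y))"
      by (simp add: extension_def c_def)
    finally have "norm (osc_op \<psi> lam f (x,y)) \<le> (LINT q|square R. norm (h q * extension lam (g q) (x,y)))"
      by (metis integral_norm_bound)
    \<comment> \<open>The sharp quadrant in \<open>(x, y)\<close> is harmless here: it multiplies
      the finished \<open>t\<close> integral and has modulus at most 1.\<close>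
    also have "\<dots> \<le> (LINT q|square R. X q (x,y))"
    proof (rule integral_mono)
      show iX: "integrable (square R) (\<lambda>q. X q (x,y))"
        by (rule B.integrable_const_bound[where B="LINT t|lborel. m t"]) (use Xle X0 in auto)
      have le: "norm (h q * extension lam (g q) (x,y)) \<le> X q (x,y)" for q
        using mult_right_mono[OF h1[of q], of "norm (extension lam (g q) (x,y))"] by (simp add: norm_mult X_def)
      then show "norm (h q * extension lam (g q) (x,y)) \<le> X q (x,y)" for q .
      have "(\<lambda>q. extension lam (g q) (x,y)) \<in> borel_measurable (borel \<Otimes>\<^sub>M borel)"
        unfolding extension_def by measurable
      then show "integrable (square R) (\<lambda>q. norm (h q * extension lam (g q) (x,y)))"
        by (intro Bochner_Integration.integrable_bound[OF iX]) (use le X0 in auto)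
    qed
    finally show ?thesis .
  qed
  define n where "n = 2 * k"
  have n: "n \<ge> 1" using k by (simp add: n_def)
  have Xn: "0 \<le> X q p ^ n" "X q p ^ n \<le> (LINT t|lborel. m t) ^ n" for q p
    by (auto intro!: power_mono Xle X0 zero_le_power)
  have \<mu>0: "\<mu> \<ge> 0" by (simp add: \<mu>_def)
  have pt: "ennreal (norm (osc_op \<psi> lam f p) ^ n) \<le> ennreal (\<mu> ^ (n - 1)) * (\<integral>\<^sup>+q. ennreal (X q p ^ n) \<partial>square R)" for p
  proof (cases p)
    case (Pair x y)
    show ?thesis
    proof (cases "\<bar>x\<bar> \<le> R \<and> \<bar>y\<bar> \<le> R")
      case True
      have "norm (osc_op \<psi> lam f p) ^ n \<le> (LINT q|square R. X q p) ^ n"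
        unfolding Pair using osc True by (intro power_mono) auto
      also have "\<dots> \<le> \<mu> ^ (n - 1) * (LINT q|square R. X q p ^ n)"
        unfolding \<mu>_def by (rule B.power_integral_le[OF _ X0 Xle n]) (simp add: Pair)
      finally have "ennreal (norm (osc_op \<psi> lam f p) ^ n) \<le> ennreal (\<mu> ^ (n - 1)) * ennreal (LINT q|square R. X q p ^ n)"
        using \<mu>0 by (simp add: ennreal_mult'[symmetric] ennreal_leI)
      also have "ennreal (LINT q|square R. X q p ^ n) = (\<integral>\<^sup>+q. ennreal (X q p ^ n) \<partial>square R)"
        by (rule nn_integral_eq_integral[symmetric])
           (use Xn[of _ p] in \<open>auto intro!: B.integrable_const_bound[where B="(LINT t|lborel. m t) ^ n"] AE_I2 simp: Pair\<close>)
      finally show ?thesis .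
    next
      case False
      then have "osc_op \<psi> lam f p = 0" by (simp add: Pair osc_op_def \<psi>supp)
      then show ?thesis using n by (simp add: zero_power)
    qed
  qed
  have om [measurable]: "osc_op \<psi> lam f \<in> borel_measurable borel" by (rule borel_measurable_osc_op[OF \<psi> f])
  have om' [measurable]: "osc_op \<psi> lam f \<in> borel_measurable (borel \<Otimes>\<^sub>M borel)" using om by (simp add: borel_prod)
  have g2: "(\<integral>\<^sup>+t. ennreal ((norm (g q t))\<^sup>2) \<partial>lborel) \<le> ennreal (M\<^sup>2 * I)" for q
  proof -
    have "(\<integral>\<^sup>+t. ennreal ((norm (g q t))\<^sup>2) \<partial>lborel) \<le> (\<integral>\<^sup>+t. ennreal (M\<^sup>2 * (norm (f t))\<^sup>2) \<partial>lborel)"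
      by (intro nn_integral_mono ennreal_leI)
         (auto simp: g_def norm_mult power_mult_distrib intro!: mult_right_mono power_mono \<Psi>M)
    also have "\<dots> = ennreal (M\<^sup>2 * I)"
      using f2 unfolding I_def by (subst nn_integral_eq_integral) auto
    finally show ?thesis .
  qed
  have I0: "I \<ge> 0" by (simp add: I_def)
  have "(\<integral>\<^sup>+p. ennreal (norm (osc_op \<psi> lam f p) ^ n) \<partial>lborel) = (\<integral>\<^sup>+p. ennreal (norm (osc_op \<psi> lam f p) ^ n) \<partial>square R)"
  proof (rule nn_integral_lborel_eq_square)
    show "ennreal (norm (osc_op \<psi> lam f (x,y)) ^ n) = 0" if "\<not> (\<bar>x\<bar> \<le> R \<and> \<bar>y\<bar> \<le> R)" for x y
      using n by (simp add: osc_op_def \<psi>supp[OF that] zero_power)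
  qed measurable
  also have "\<dots> \<le> (\<integral>\<^sup>+p. ennreal (\<mu> ^ (n - 1)) * (\<integral>\<^sup>+q. ennreal (X q p ^ n) \<partial>square R) \<partial>square R)"
    by (intro nn_integral_mono pt)
  also have "\<dots> = ennreal (\<mu> ^ (n - 1)) * (\<integral>\<^sup>+p. \<integral>\<^sup>+q. ennreal (X q p ^ n) \<partial>square R \<partial>square R)"
    by (rule nn_integral_cmult) measurable
  \<comment> \<open>With the corner integral outermost, the inner integral is the amplitude-free
    quantity for one fixed function \<open>g q\<close>.\<close>
  also have "(\<integral>\<^sup>+p. \<integral>\<^sup>+q. ennreal (X q p ^ n) \<partial>square R \<partial>square R) = (\<integral>\<^sup>+q. \<integral>\<^sup>+p. ennreal (X q p ^ n) \<partial>square R \<partial>square R)"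
  proof -
    interpret BB: pair_sigma_finite "square R" "square R" ..
    show ?thesis by (rule BB.Fubini') measurable
  qed
  also have "ennreal (\<mu> ^ (n - 1)) * \<dots> \<le> ennreal (\<mu> ^ (n - 1)) * (\<integral>\<^sup>+q. ennreal K * ennreal (M\<^sup>2 * I) ^ k \<partial>square R)"
  proof (intro mult_left_mono nn_integral_mono)
    fix q
    have "(\<integral>\<^sup>+p. ennreal (X q p ^ n) \<partial>square R) \<le> ennreal K * (\<integral>\<^sup>+t. ennreal ((norm (g q t))\<^sup>2) \<partial>lborel) ^ k"
      unfolding X_def n_def by (rule ext[OF gi gsupp])
    also have "\<dots> \<le> ennreal K * ennreal (M\<^sup>2 * I) ^ k"
      by (intro mult_left_mono power_mono g2) auto
    finally show "(\<integral>\<^sup>+p. ennreal (X q p ^ n) \<partial>square R) \<le> ennreal K * ennreal (M\<^sup>2 * I) ^ k" .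
  qed simp
  also have "\<dots> = ennreal (\<mu> ^ (n - 1)) * (ennreal K * ennreal (M\<^sup>2 * I) ^ k * ennreal \<mu>)"
    by (simp add: B.emeasure_eq_measure \<mu>_def)
  also have "\<dots> = ennreal (\<mu> ^ (n - 1) * (K * (M\<^sup>2 * I) ^ k * \<mu>))"
  proof -
    have "ennreal (M\<^sup>2 * I) ^ k = ennreal ((M\<^sup>2 * I) ^ k)"
      using I0 by (intro ennreal_power) simp
    then show ?thesis using K I0 \<mu>0 by (simp only:) (simp add: ennreal_mult)
  qed
  \<comment> \<open>Jensen costs \<open>n - 1\<close> powers of the mass and the integration over
    corners one more; each of the \<open>k\<close> factors contributes \<open>M^2\<close>, in total
    \<open>M ^ n\<close>.\<close>
  also have "\<mu> ^ (n - 1) * (K * (M\<^sup>2 * I) ^ k * \<mu>) = (\<mu> * M) ^ n * K * I ^ k"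
  proof -
    have e1: "\<mu> ^ (n - 1) * \<mu> = \<mu> ^ n" using n by (cases n) auto
    have e2: "(M\<^sup>2 * I) ^ k = M ^ n * I ^ k" by (simp add: n_def power_mult_distrib power_mult)
    have "\<mu> ^ (n - 1) * (K * (M ^ n * I ^ k) * \<mu>) = (\<mu> ^ (n - 1) * \<mu>) * M ^ n * K * I ^ k"
      by (simp only: mult_ac)
    also have "\<dots> = (\<mu> * M) ^ n * K * I ^ k" by (simp only: e1 power_mult_distrib)
    finally show ?thesis by (simp only: e2)
  qed
  finally show ?thesis by (simp add: n_def \<mu>_def I_def)
qed

lemma in_Lp_even_norm_le:
  fixes F :: "'a \<Rightarrow> 'b::{banach,second_countable_topology}"
  assumes p: "p = real (2 * k)" "k \<ge> 1" and F: "F \<in> borel_measurable N"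
    and C: "C \<ge> 0" and le: "(\<integral>\<^sup>+x. ennreal (norm (F x) ^ (2 * k)) \<partial>N) \<le> ennreal C"
  shows "in_Lp p N F" "Lp_norm p N F \<le> C powr (1 / p)"
proof -
  \<comment> \<open>The two notions of power agree for a positive base; at base 0 both sides vanish,
    the natural power because \<open>k \<ge> 1\<close>.\<close>
  have eq: "norm (F x) powr p = norm (F x) ^ (2 * k)" for x
    using p by (cases "norm (F x) = 0") (auto simp: powr_realpow simp del: of_nat_mult)
  have i: "integrable N (\<lambda>x. norm (F x) ^ (2 * k))"
    by (rule integrableI_bounded) (use F le in \<open>auto simp: le_less_trans[OF _ ennreal_less_top]\<close>)
  then show "in_Lp p N F" using F by (simp add: in_Lp_def eq)
  have "ennreal (LINT x|N. norm (F x) ^ (2 * k)) \<le> ennreal C"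
    using le i by (subst nn_integral_eq_integral[symmetric]) auto
  then have "(LINT x|N. norm (F x) ^ (2 * k)) \<le> C" using C by simp
  then show "Lp_norm p N F \<le> C powr (1 / p)"
    unfolding Lp_norm_def eq using p by (intro powr_mono2) auto
qed

text \<open>Both estimates are instances, with \<open>k = 1\<close> and \<open>k = 3\<close>. In
  \<open>ext\<close> the constant \<open>K\<close> is chosen before \<open>lam\<close> and
  \<open>g\<close> and may depend only on \<open>R\<close>, which comes from the support of the
  amplitude; so the final constant depends on the amplitude alone.\<close>

lemma osc_op_Lp_bound:
  fixes \<psi> :: "real \<times> real \<times> real \<Rightarrow> complex" and k :: nat
  assumes \<psi>: "Cc_inf \<psi>" and k: "k \<ge> 1" and p: "p = real (2 * k)"
    and ext: "\<And>R. R > 0 \<Longrightarrow> \<exists>K\<ge>0. \<forall>lam>0. \<forall>g. integrable lborel g \<longrightarrow> (\<forall>t. \<bar>t\<bar> > R \<longrightarrow> g t = 0) \<longrightarrow>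
      (\<integral>\<^sup>+p. ennreal (norm (extension lam g p) ^ (2 * k)) \<partial>square R)
        \<le> ennreal (K * lam powr (- (p * \<alpha>))) * (\<integral>\<^sup>+t. ennreal ((norm (g t))\<^sup>2) \<partial>lborel) ^ k"
  obtains C where "C \<ge> 0" "\<And>lam f. lam > 0 \<Longrightarrow> in_Lp 2 lborel f \<Longrightarrow>
      in_Lp p lborel (osc_op \<psi> lam f) \<and>
      Lp_norm p lborel (osc_op \<psi> lam f) \<le> C * lam powr (- \<alpha>) * Lp_norm 2 lborel f"
proof -
  have \<psi>m: "\<psi> \<in> borel_measurable borel"
    using \<psi> by (intro borel_measurable_continuous_onI smooth_continuous_on) (simp add: Cc_inf_def)
  obtain R M \<Psi> where rep: "R > 0" "M > 0" "\<Psi> \<in> borel_measurable borel" "\<And>p. norm (\<Psi> p) \<le> M"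
    "\<And>x y t. \<bar>t\<bar> > R \<Longrightarrow> \<Psi> (x,y,t) = 0"
    "\<And>x y t. \<not> (\<bar>x\<bar> \<le> R \<and> \<bar>y\<bar> \<le> R) \<Longrightarrow> \<psi> (x,y,t) = 0"
    "\<And>x y t. \<bar>x\<bar> \<le> R \<Longrightarrow> \<bar>y\<bar> \<le> R \<Longrightarrow>
       \<psi> (x,y,t) = (LINT q|square R. indicator {x..} (fst q) * indicator {y..} (snd q) * \<Psi> (fst q, snd q, t))"
    by (rule Cc_inf_integral_representation[OF \<psi>]) (rule that)
  obtain K where K: "K \<ge> 0" and Kext: "\<And>lam g. lam > 0 \<Longrightarrow> integrable lborel g \<Longrightarrow> (\<And>t. \<bar>t\<bar> > R \<Longrightarrow> g t = 0) \<Longrightarrow>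
      (\<integral>\<^sup>+p. ennreal (norm (extension lam g p) ^ (2 * k)) \<partial>square R)
        \<le> ennreal (K * lam powr (- (p * \<alpha>))) * (\<integral>\<^sup>+t. ennreal ((norm (g t))\<^sup>2) \<partial>lborel) ^ k"
    using ext[OF rep(1)] by blast
  define \<mu> where "\<mu> = measure (square R) (space (square R)) * M"
  have \<mu>: "\<mu> \<ge> 0" using rep(2) by (simp add: \<mu>_def)
  have p0: "p > 0" using k p by simp
  define C where "C = (\<mu> ^ (2 * k) * K) powr (1 / p)"
  show ?thesis
  proof (rule that[of C])
    fix lam :: real and f :: "real \<Rightarrow> complex" assume lam: "lam > 0" and f: "in_Lp 2 lborel f"
    have fm: "f \<in> borel_measurable borel" and f2: "integrable lborel (\<lambda>t. (norm (f t))\<^sup>2)"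
      using f by (auto simp: in_Lp_def)
    define I where "I = (LINT t|lborel. (norm (f t))\<^sup>2)"
    have I: "I \<ge> 0" by (simp add: I_def)
    define D where "D = \<mu> ^ (2 * k) * (K * lam powr (- (p * \<alpha>))) * I ^ k"
    have D0: "D \<ge> 0" using \<mu> K I by (simp add: D_def)
    have "(\<integral>\<^sup>+p. ennreal (norm (osc_op \<psi> lam f p) ^ (2 * k)) \<partial>lborel) \<le> ennreal D"
      unfolding D_def \<mu>_def I_def
      by (rule osc_op_nn_integral_bound[OF rep(1-5) \<psi>m rep(6,7) _ k Kext[OF lam] fm f2]) (use K in auto)
    note L = in_Lp_even_norm_le[OF p k _ D0 this]
    have om: "osc_op \<psi> lam f \<in> borel_measurable lborel"
      using borel_measurable_osc_op[OF \<psi>m fm] by simp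
    have "D powr (1 / p) = (\<mu> ^ (2 * k) * K) powr (1 / p) * (lam powr (- (p * \<alpha>))) powr (1 / p) * (I ^ k) powr (1 / p)"
    proof -
      have "D = \<mu> ^ (2 * k) * K * lam powr (- (p * \<alpha>)) * I ^ k" by (simp add: D_def mult_ac)
      then show ?thesis using \<mu> K I by (simp add: powr_mult)
    qed
    also have "(lam powr (- (p * \<alpha>))) powr (1 / p) = lam powr (- \<alpha>)"
      using p0 by (simp add: powr_powr)
    \<comment> \<open>Since \<open>p = 2 * k\<close>, the \<open>k\<close>-th power of the squared
      norm becomes the norm itself.\<close>
    also have "(I ^ k) powr (1 / p) = I powr (1 / 2)"
    proof (cases "I = 0")
      case False
      then have "(I ^ k) powr (1 / p) = (I powr real k) powr (1 / p)" using I by (simp add: powr_realpow)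
      then show ?thesis using k by (simp add: powr_powr p)
    qed (use k in \<open>simp add: zero_power\<close>)
    also have "I powr (1 / 2) = Lp_norm 2 lborel f"
      by (simp add: Lp_norm_def I_def)
    finally show "in_Lp p lborel (osc_op \<psi> lam f) \<and>
      Lp_norm p lborel (osc_op \<psi> lam f) \<le> C * lam powr (- \<alpha>) * Lp_norm 2 lborel f"
      using L[OF om] by (simp add: C_def)
  qed (simp add: C_def)
qed

lemma osc_op_L2_estimate:
  fixes \<psi> :: "real \<times> real \<times> real \<Rightarrow> complex"
  assumes "Cc_inf \<psi>"
  obtains C where "C \<ge> 0" "\<And>lam f. lam > 0 \<Longrightarrow> in_Lp 2 lborel f \<Longrightarrow>
      in_Lp 2 lborel (osc_op \<psi> lam f) \<and>
      Lp_norm 2 lborel (osc_op \<psi> lam f) \<le> C * lam powr (- (3/8)) * Lp_norm 2 lborel f"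
proof (rule osc_op_Lp_bound[OF assms, of 1 2 "3/8"])
  fix R :: real assume "R > 0"
  show "\<exists>K\<ge>0. \<forall>lam>0. \<forall>g. integrable lborel g \<longrightarrow> (\<forall>t. \<bar>t\<bar> > R \<longrightarrow> g t = 0) \<longrightarrow>
      (\<integral>\<^sup>+p. ennreal (norm (extension lam g p) ^ (2 * 1)) \<partial>square R)
        \<le> ennreal (K * lam powr (- (2 * (3/8)))) * (\<integral>\<^sup>+t. ennreal ((norm (g t))\<^sup>2) \<partial>lborel) ^ 1"
    using extension_L2_bound[of _ _ R]
    by (intro exI[of _ "sqrt (2 * pi) * exp (R\<^sup>2 / 2) * (16 * pi * (1 + 4 * pi))"]) simp
qed (use that in auto)

lemma osc_op_L6_estimate:
  fixes \<psi> :: "real \<times> real \<times> real \<Rightarrow> complex"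
  assumes "Cc_inf \<psi>"
  obtains C where "C \<ge> 0" "\<And>lam f. lam > 0 \<Longrightarrow> in_Lp 2 lborel f \<Longrightarrow>
      in_Lp 6 lborel (osc_op \<psi> lam f) \<and>
      Lp_norm 6 lborel (osc_op \<psi> lam f) \<le> C * lam powr (- (1/4)) * Lp_norm 2 lborel f"
proof (rule osc_op_Lp_bound[OF assms, of 3 6 "1/4"])
  fix R :: real assume "R > 0"
  then show "\<exists>K\<ge>0. \<forall>lam>0. \<forall>g. integrable lborel g \<longrightarrow> (\<forall>t. \<bar>t\<bar> > R \<longrightarrow> g t = 0) \<longrightarrow>
      (\<integral>\<^sup>+p. ennreal (norm (extension lam g p) ^ (2 * 3)) \<partial>square R)
        \<le> ennreal (K * lam powr (- (6 * (1/4)))) * (\<integral>\<^sup>+t. ennreal ((norm (g t))\<^sup>2) \<partial>lborel) ^ 3"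
    using extension_L6_bound[of _ R]
    by (intro exI[of _ "sqrt (2 * pi) * exp (R\<^sup>2 / 2) * (8 * pi\<^sup>2 * (1 + 4 * pi) * sqrt (7 * R))"]) simp
qed (use that in auto)

section \<open>Sharpness\<close>

text \<open>The classical flat function exp(-1/u), multiplied by powers of 1/u so that derivatives
  are linear combinations of members of the same family.\<close>

definition flat_exp :: "nat \<Rightarrow> real \<Rightarrow> real" where
  "flat_exp n u = (if u \<le> 0 then 0 else inverse u ^ n * exp (- inverse u))"

lemma flat_exp_has_real_derivative:
  "(flat_exp n has_real_derivative (flat_exp (n + 2) u - real n * flat_exp (n + 1) u)) (at u)"
proof -
  consider "u > 0" | "u < 0" | "u = 0" by linarith
  then show ?thesis
  proof cases
    case 1
    have "((\<lambda>u. inverse u ^ n * exp (- inverse u)) has_real_derivative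
        (inverse u ^ n * (exp (- inverse u) * inverse u ^ 2) - real n * inverse u ^ (n - 1) * inverse u ^ 2 * exp (- inverse u))) (at u)"
      using 1 by (auto intro!: derivative_eq_intros simp: power2_eq_square)
    also have "inverse u ^ n * (exp (- inverse u) * inverse u ^ 2) - real n * inverse u ^ (n - 1) * inverse u ^ 2 * exp (- inverse u)
        = flat_exp (n + 2) u - real n * flat_exp (n + 1) u"
      using 1 by (cases n) (auto simp: flat_exp_def power_add power2_eq_square)
    finally show ?thesis
      by (rule has_field_derivative_transform_within_open[where S="{0<..}"]) (use 1 in \<open>auto simp: flat_exp_def\<close>)
  next
    case 2
    have "((\<lambda>_. 0 :: real) has_real_derivative 0) (at u)" by simp
    then have "(flat_exp n has_real_derivative 0) (at u)"
      by (rule has_field_derivative_transform_within_open[where S="{..<0}"]) (use 2 in \<open>auto simp: flat_exp_def\<close>)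
    then show ?thesis using 2 by (simp add: flat_exp_def)
  next
    case 3
    \<comment> \<open>At 0 the difference quotient from the right is a power of \<open>1 / h\<close>
      divided by the exponential of \<open>1 / h\<close>, so it tends to 0; from the left it is
      identically 0.\<close>
    have "((\<lambda>h. inverse h ^ (n + 1) / exp (inverse h)) \<longlongrightarrow> (0::real)) (at_right 0)"
      by (rule filterlim_compose[OF tendsto_power_div_exp_0 filterlim_inverse_at_top_right])
    then have "((\<lambda>h. flat_exp n h / h) \<longlongrightarrow> 0) (at_right 0)"
      by (rule Lim_transform_eventually)
         (auto simp: eventually_at_right_field flat_exp_def exp_minus field_simps intro!: exI[of _ 1])
    moreover have "((\<lambda>h. flat_exp n h / h) \<longlongrightarrow> 0) (at_left 0)"
      by (rule tendsto_eventually) (auto simp: eventually_at_left_field flat_exp_def intro!: exI[of _ "-1"])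
    ultimately have "((\<lambda>h. flat_exp n h / h) \<longlongrightarrow> 0) (at 0)"
      by (simp add: filterlim_split_at)
    then show ?thesis using 3 by (simp add: DERIV_def flat_exp_def)
  qed
qed

text \<open>Being closed under directional derivatives, this class is an invariant for the coinductive
  definition of \<^const>\<open>smooth\<close>.\<close>
inductive bump_algebra :: "('a::real_inner \<Rightarrow> complex) \<Rightarrow> bool" where
  const: "bump_algebra (\<lambda>_. c)"
| inner: "bump_algebra (\<lambda>p. of_real (p \<bullet> v))"
| flat_exp: "bump_algebra (\<lambda>p. of_real (flat_exp n (1 - p \<bullet> p)))"
| add: "bump_algebra f \<Longrightarrow> bump_algebra g \<Longrightarrow> bump_algebra (\<lambda>p. f p + g p)"
| mult: "bump_algebra f \<Longrightarrow> bump_algebra g \<Longrightarrow> bump_algebra (\<lambda>p. f p * g p)"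

text \<open>The direction \<open>v\<close> is held fixed and the base point varies. The chain rule
  for the squared length produces the factor \<open>x \<bullet> v\<close>, which is why linear
  functionals are among the generators.\<close>

lemma bump_algebra_has_derivative:
  "bump_algebra f \<Longrightarrow> \<exists>F. (\<forall>x. (f has_derivative F x) (at x)) \<and> (\<forall>v. bump_algebra (\<lambda>x. F x v))"
proof (induction rule: bump_algebra.induct)
  case (const c)
  show ?case by (rule exI[of _ "\<lambda>_ _. 0"]) (auto intro: bump_algebra.const)
next
  case (inner v)
  show ?case
    by (rule exI[of _ "\<lambda>_ h. of_real (h \<bullet> v)"])
       (auto intro!: bump_algebra.const derivative_eq_intros)
next
  case (flat_exp n)
  let ?F = "\<lambda>x h. of_real (flat_exp (n + 2) (1 - x \<bullet> x) - real n * flat_exp (n + 1) (1 - x \<bullet> x)) * (of_real (-2) * of_real (x \<bullet> h)) :: complex"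
  have "((\<lambda>p. complex_of_real (flat_exp n (1 - p \<bullet> p))) has_derivative ?F x) (at x)" for x :: 'a
  proof -
    have i: "((\<lambda>p::'a. 1 - p \<bullet> p) has_derivative (\<lambda>h. - 2 * (x \<bullet> h))) (at x)"
      by (auto intro!: derivative_eq_intros simp: inner_commute)
    have "((\<lambda>p. flat_exp n (1 - p \<bullet> p)) has_derivative (\<lambda>h. (flat_exp (n + 2) (1 - x \<bullet> x) - real n * flat_exp (n + 1) (1 - x \<bullet> x)) * (- 2 * (x \<bullet> h)))) (at x)"
      using has_derivative_compose[OF i flat_exp_has_real_derivative[unfolded has_field_derivative_def]] .
    from has_derivative_of_real[OF this] show ?thesis by simp
  qed
  moreover have "bump_algebra (\<lambda>x. ?F x v)" for v :: 'a
  proof -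
    have "bump_algebra (\<lambda>x. (of_real (flat_exp (n + 2) (1 - x \<bullet> x)) + of_real (- real n) * of_real (flat_exp (n + 1) (1 - x \<bullet> x)))
       * (of_real (-2) * of_real (x \<bullet> v)))"
      by (intro bump_algebra.intros)
    then show ?thesis by simp
  qed
  ultimately show ?case by (intro exI[of _ ?F] conjI allI)
next
  case (add f g)
  then obtain F G where "\<forall>x. (f has_derivative F x) (at x)" "\<forall>v. bump_algebra (\<lambda>x. F x v)"
    "\<forall>x. (g has_derivative G x) (at x)" "\<forall>v. bump_algebra (\<lambda>x. G x v)" by blast
  then show ?case
    by (intro exI[of _ "\<lambda>x h. F x h + G x h"]) (auto intro: bump_algebra.intros has_derivative_add)
next
  case (mult f g)
  then obtain F G where "\<forall>x. (f has_derivative F x) (at x)" "\<forall>v. bump_algebra (\<lambda>x. F x v)"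
    "\<forall>x. (g has_derivative G x) (at x)" "\<forall>v. bump_algebra (\<lambda>x. G x v)" by blast
  then show ?case using mult.hyps
    by (intro exI[of _ "\<lambda>x h. f x * G x h + F x h * g x"]) (auto intro!: bump_algebra.intros has_derivative_mult)
qed

lemma bump_algebra_smooth: "bump_algebra f \<Longrightarrow> smooth f"
proof (coinduction arbitrary: f rule: smooth.coinduct)
  case smooth
  then obtain F where F: "\<And>x. (f has_derivative F x) (at x)" "\<And>v. bump_algebra (\<lambda>x. F x v)"
    using bump_algebra_has_derivative by blast
  have "frechet_derivative f (at x) = F x" for x
    using frechet_derivative_at[OF F(1)] by simp
  then show ?case using F by (auto simp: differentiable_def)
qed

text \<open>The standard mollifier profile exp(-1/(1 - |p|^2)) on the open unit ball, extended by 0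
  and made complex valued.\<close>

definition bump :: "'a::real_inner \<Rightarrow> complex" where
  "bump p = of_real (flat_exp 0 (1 - p \<bullet> p))"

lemma Cc_inf_bump: "Cc_inf (bump :: 'a::euclidean_space \<Rightarrow> complex)"
proof -
  have "smooth (bump :: 'a \<Rightarrow> complex)"
    unfolding bump_def[abs_def] by (intro bump_algebra_smooth bump_algebra.flat_exp)
  moreover have "{p::'a. bump p \<noteq> 0} \<subseteq> cball 0 1"
  proof
    fix p :: 'a assume "p \<in> {p. bump p \<noteq> 0}"
    then have "p \<bullet> p < 1" by (auto simp: bump_def flat_exp_def split: if_splits)
    then have "(norm p)\<^sup>2 \<le> 1\<^sup>2" by (simp add: power2_norm_eq_inner)
    then have "norm p \<le> 1" by (rule power2_le_imp_le) simp
    then show "p \<in> cball 0 1" by simp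
  qed
  then have "bounded {p::'a. bump p \<noteq> 0}" using bounded_cball bounded_subset by blast
  ultimately show ?thesis by (simp add: Cc_inf_def compact_support_def compact_closure)
qed

section \<open>Lower bounds without cancellation and the critical exponent\<close>

lemma integrable_indicator_Icc: "integrable lborel (indicator {a..b::real} :: real \<Rightarrow> real)"
  using emeasure_compact_finite[OF compact_Icc, of a b] by (intro integrable_real_indicator) auto

text \<open>On this rectangle the phase is at most 3/4, which is below pi/3, so the cosine is at
  least 1/2. The threshold 8 keeps the squared length of \<open>(x, y, t)\<close> below 1/2, so the
  bump is at least exp(-2). The real part over an interval of length 1/2 then gives the
  constant.\<close>

lemma osc_op_bump_lower_bound:
  assumes lam: "lam \<ge> 8" and x: "\<bar>x\<bar> \<le> 1 / lam" and y: "\<bar>y\<bar> \<le> 1 / sqrt lam"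
  shows "exp (-2) / 4 \<le> norm (osc_op bump lam (indicator {0..1/2}) (x,y))"
proof -
  define c where "c t = cos (lam * (x * t\<^sup>2 + y\<^sup>2 * t)) * flat_exp 0 (1 - (x,y,t) \<bullet> (x,y,t)) * indicator {0..1/2} t" for t
  define h where "h t = exp (\<i> * complex_of_real (lam * (x * t\<^sup>2 + y\<^sup>2 * t))) * bump (x,y,t) * indicator {0..1/2} t" for t
  have bm [measurable]: "(bump :: real \<times> real \<times> real \<Rightarrow> complex) \<in> borel_measurable borel"
    using Cc_inf_bump[where 'a="real \<times> real \<times> real"] by (intro borel_measurable_continuous_onI smooth_continuous_on) (simp add: Cc_inf_def)
  have hm [measurable]: "h \<in> borel_measurable borel"
    unfolding h_def cis_conv_exp[symmetric] by measurable
  have hi: "integrable lborel h"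
  proof (rule Bochner_Integration.integrable_bound[of _ "indicator {0..1/2} :: real \<Rightarrow> real"])
    have "norm (bump p) \<le> 1" for p :: "real \<times> real \<times> real" by (auto simp: bump_def flat_exp_def)
    then show "AE t in lborel. norm (h t) \<le> norm (indicator {0..1/2} t :: real)"
      by (auto simp: h_def norm_mult indicator_def)
  qed (use integrable_indicator_Icc hm in auto)
  have Re: "Re (h t) = c t" for t
    by (simp add: h_def c_def bump_def Re_exp indicator_def)
  have ci: "integrable lborel c" using integrable_Re[OF hi] by (simp add: Re)
  have low: "exp (-2) / 2 * indicator {0..1/2} t \<le> c t" for t
  proof (cases "t \<in> {0..1/2}")
    case True
    have lam0: "lam > 0" using lam by simp
    have y2: "y\<^sup>2 \<le> 1 / lam"
      using power_mono[OF y abs_ge_zero, of 2] lam0 by (simp add: power_divide)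
    have t2: "t\<^sup>2 \<le> 1/4" using power_mono[of t "1/2" 2] True by (simp add: power_divide)
    have x1: "\<bar>x\<bar> \<le> 1/8" using x lam by (smt (verit) frac_le)
    have x2: "x\<^sup>2 \<le> 1/64" using power_mono[OF x1 abs_ge_zero, of 2] by (simp add: power_divide)
    have y3: "y\<^sup>2 \<le> 1/8" using y2 lam by (smt (verit) frac_le)
    have "\<bar>lam * (x * t\<^sup>2 + y\<^sup>2 * t)\<bar> = lam * \<bar>x * t\<^sup>2 + y\<^sup>2 * t\<bar>" using lam0 by (simp add: abs_mult)
    also have "\<dots> \<le> lam * (1 / lam * (1/4) + 1 / lam * (1/2))"
    proof (intro mult_left_mono order_trans[OF abs_triangle_ineq] add_mono)
      show "\<bar>x * t\<^sup>2\<bar> \<le> 1 / lam * (1/4)"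
        unfolding abs_mult using x t2 lam0 by (intro mult_mono) auto
      show "\<bar>y\<^sup>2 * t\<bar> \<le> 1 / lam * (1/2)"
        unfolding abs_mult using y2 True lam0 by (intro mult_mono) auto
    qed (use lam0 in simp)
    also have "\<dots> \<le> 1" using lam0 by (simp add: field_simps)
    finally have ph: "\<bar>lam * (x * t\<^sup>2 + y\<^sup>2 * t)\<bar> \<le> 1" .
    have "cos (pi / 3) \<le> cos \<bar>lam * (x * t\<^sup>2 + y\<^sup>2 * t)\<bar>"
      using ph pi_gt3 by (intro cos_monotone_0_pi_le) auto
    then have cos: "1/2 \<le> cos (lam * (x * t\<^sup>2 + y\<^sup>2 * t))" by (simp add: cos_60)
    define u where "u = 1 - (x,y,t) \<bullet> (x,y,t)"
    have "u = 1 - (x\<^sup>2 + (y\<^sup>2 + t\<^sup>2))" by (simp add: u_def inner_prod_def power2_eq_square)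
    then have u: "u \<ge> 1/2" using x2 y3 t2 by simp
    then have "inverse u \<le> inverse (1/2)" by (intro le_imp_inverse_le) auto
    then have "exp (-2) \<le> flat_exp 0 u" using u by (simp add: flat_exp_def)
    then have "1/2 * exp (-2) \<le> cos (lam * (x * t\<^sup>2 + y\<^sup>2 * t)) * flat_exp 0 u"
      using cos by (intro mult_mono) auto
    then show ?thesis using True by (simp add: c_def u_def)
  qed (simp add: c_def)
  have "(exp (-2) / 4 :: real) = (LINT t|lborel. exp (-2) / 2 * indicator {0..1/2::real} t)" by simp
  also have "\<dots> \<le> (LINT t|lborel. c t)"
    by (intro integral_mono ci low integrable_mult_right integrable_indicator_Icc)
  also have "\<dots> = Re (LINT t|lborel. h t)" using integral_Re[OF hi] by (simp add: Re)
  also have "\<dots> \<le> norm (LINT t|lborel. h t)" by (rule complex_Re_le_cmod)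
  also have "(LINT t|lborel. h t) = osc_op bump lam (indicator {0..1/2}) (x,y)"
    by (simp add: osc_op_def h_def)
  finally show ?thesis .
qed

lemma in_Lp_indicator_half: "in_Lp 2 lborel (indicator {0..1/2} :: real \<Rightarrow> complex)"
proof -
  have "norm (indicator {0..1/2} t :: complex) powr 2 = indicator {0..1/2} t" for t :: real
    by (simp add: indicator_def)
  then show ?thesis using integrable_indicator_Icc[of 0 "1/2"] by (simp add: in_Lp_def)
qed

text \<open>The rectangle \<open>Q\<close> has area \<open>4 * lam powr (-3/2)\<close>, and the
  sixth root of the power gives the decay; the factor 4 is discarded. The assumption
  \<open>i\<close> excludes that the integral in \<open>Lp_norm\<close> takes the default value
  0.\<close>

lemma osc_op_bump_L6_lower_bound:
  assumes lam: "lam \<ge> 8" and i: "in_Lp 6 lborel (osc_op bump lam (indicator {0..1/2}))"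
  shows "exp (-2) / 4 * lam powr (-1/4) \<le> Lp_norm 6 lborel (osc_op bump lam (indicator {0..1/2}))"
proof -
  have lam0: "lam > 0" using lam by simp
  define c :: real where "c = exp (-2) / 4"
  define Q where "Q = {-(1 / lam)..1 / lam} \<times> {-(1 / sqrt lam)..1 / sqrt lam}"
  define F where "F = osc_op bump lam (indicator {0..1/2})"
  have c: "c > 0" by (simp add: c_def)
  have eq: "norm (F p) powr 6 = norm (F p) ^ 6" for p by simp
  have Q: "emeasure lborel Q = ennreal (4 * (1 / (lam * sqrt lam)))"
  proof -
    have "emeasure lborel Q = emeasure (lborel \<Otimes>\<^sub>M lborel) Q" by (simp add: lborel_prod)
    also have "\<dots> = emeasure lborel {-(1 / lam)..1 / lam} * emeasure lborel {-(1 / sqrt lam)..1 / sqrt lam}"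
      unfolding Q_def by (rule lborel.emeasure_pair_measure_Times) auto
    also have "\<dots> = ennreal (4 * (1 / (lam * sqrt lam)))"
      using lam0 by (simp add: emeasure_lborel_Icc_eq ennreal_mult[symmetric])
    finally show ?thesis .
  qed
  have Qs: "Q \<in> sets lborel"
  proof -
    have "closed Q" unfolding Q_def by (intro closed_Times) auto
    then show ?thesis by simp
  qed
  have "c ^ 6 * (4 * (1 / (lam * sqrt lam))) = (LINT p|lborel. c ^ 6 * indicator Q p)"
    using Q Qs lam0 by (simp add: measure_def)
  also have "\<dots> \<le> (LINT p|lborel. norm (F p) powr 6)"
  proof (rule integral_mono)
    show "integrable lborel (\<lambda>p. c ^ 6 * indicator Q p)" using Q Qs by simp
    show "integrable lborel (\<lambda>p. norm (F p) powr 6)" using i by (simp add: in_Lp_def F_def)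
    fix p :: "real \<times> real"
    show "c ^ 6 * indicator Q p \<le> norm (F p) powr 6"
    proof (cases "p \<in> Q")
      case True
      then have "c \<le> norm (F p)"
        using osc_op_bump_lower_bound[OF lam, of "fst p" "snd p"] by (auto simp: Q_def F_def c_def abs_le_iff minus_le_iff)
      then show ?thesis unfolding eq using True c by (simp add: power_mono)
    qed simp
  qed
  finally have "c ^ 6 * (4 * (1 / (lam * sqrt lam))) \<le> (LINT p|lborel. norm (F p) powr 6)" .
  moreover have "(c * lam powr (-1/4)) powr 6 \<le> c ^ 6 * (4 * (1 / (lam * sqrt lam)))"
  proof -
    have "lam * sqrt lam = lam powr (3/2)"
      using lam0 powr_add[of lam 1 "1/2"] by (simp add: powr_half_sqrt)
    then have "1 / (lam * sqrt lam) = lam powr (-3/2)" using lam0 powr_minus_divide[of lam "3/2"] by simp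
    moreover have "(c * lam powr (-1/4)) powr 6 = c powr 6 * lam powr (-3/2)"
      using c lam0 by (simp add: powr_mult powr_powr)
    moreover have "c powr 6 = c ^ 6" using c by simp
    ultimately show ?thesis using c by simp
  qed
  ultimately have "(c * lam powr (-1/4)) powr 6 \<le> (LINT p|lborel. norm (F p) powr 6)" by linarith
  then have "((c * lam powr (-1/4)) powr 6) powr (1/6) \<le> (LINT p|lborel. norm (F p) powr 6) powr (1/6)"
    by (intro powr_mono2) auto
  moreover have "((c * lam powr (-1/4)) powr 6) powr (1/6) = c * lam powr (-1/4)"
    by (subst powr_powr) (use c in simp)
  ultimately show ?thesis by (simp add: Lp_norm_def F_def c_def)
qed

lemma decay_exponent_le:
  fixes c C \<delta> :: real
  assumes c: "c > 0" and le: "\<And>lam. lam \<ge> lam\<^sub>0 \<Longrightarrow> c * lam powr (-1/4) \<le> C * lam powr (-\<delta>)"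
  shows "\<delta> \<le> 1/4"
proof (rule ccontr)
  assume "\<not> \<delta> \<le> 1/4"
  then have d: "\<delta> - 1/4 > 0" by simp
  have "filterlim (\<lambda>lam::real. lam powr (\<delta> - 1/4)) at_top at_top" using d by real_asymp
  then have "eventually (\<lambda>lam. C / c < lam powr (\<delta> - 1/4)) at_top"
    by (simp add: filterlim_at_top_dense)
  then have "eventually (\<lambda>lam. C / c < lam powr (\<delta> - 1/4) \<and> lam \<ge> lam\<^sub>0 \<and> lam > 0) at_top"
    by (intro eventually_conj eventually_ge_at_top eventually_gt_at_top)
  then obtain lam where lam: "C / c < lam powr (\<delta> - 1/4)" "lam \<ge> lam\<^sub>0" "lam > 0"
    by (metis (mono_tags, lifting) eventually_at_top_linorder order_refl)
  have "c * lam powr (-1/4) * lam powr \<delta> \<le> C * lam powr (-\<delta>) * lam powr \<delta>"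
    by (intro mult_right_mono le lam) simp
  then have "c * lam powr (\<delta> - 1/4) \<le> C"
    using lam(3) by (simp add: mult.assoc powr_add[symmetric])
  then show False using lam(1) c by (simp add: field_simps)
qed

theorem theorem1p1:
  shows "(\<forall>\<psi> :: real \<times> real \<times> real \<Rightarrow> complex. Cc_inf \<psi> \<longrightarrow>
           (\<exists>C. \<forall>lam>0. \<forall>f. in_Lp 2 lborel f \<longrightarrow>
              (in_Lp 2 lborel (osc_op \<psi> lam f) \<and>
               Lp_norm 2 lborel (osc_op \<psi> lam f) \<le> C * lam powr (-3/8) * Lp_norm 2 lborel f) \<and>
              (in_Lp 6 lborel (osc_op \<psi> lam f) \<and>
               Lp_norm 6 lborel (osc_op \<psi> lam f) \<le> C * lam powr (-1/4) * Lp_norm 2 lborel f)))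
       \<and> (\<forall>\<delta>::real.
           (\<forall>\<psi> :: real \<times> real \<times> real \<Rightarrow> complex. Cc_inf \<psi> \<longrightarrow>
              (\<exists>C lam\<^sub>0. \<forall>lam\<ge>lam\<^sub>0. \<forall>f. in_Lp 2 lborel f \<longrightarrow>
                 in_Lp 6 lborel (osc_op \<psi> lam f) \<and>
                 Lp_norm 6 lborel (osc_op \<psi> lam f) \<le> C * lam powr (-\<delta>) * Lp_norm 2 lborel f))
           \<longrightarrow> \<delta> \<le> 1/4)"
proof (rule conjI; intro allI impI)
  fix \<psi> :: "real \<times> real \<times> real \<Rightarrow> complex" assume \<psi>: "Cc_inf \<psi>"
  obtain C2 where C2: "C2 \<ge> 0" "\<And>lam f. lam > 0 \<Longrightarrow> in_Lp 2 lborel f \<Longrightarrow>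
      in_Lp 2 lborel (osc_op \<psi> lam f) \<and>
      Lp_norm 2 lborel (osc_op \<psi> lam f) \<le> C2 * lam powr (- (3/8)) * Lp_norm 2 lborel f"
    by (rule osc_op_L2_estimate[OF \<psi>]) (rule that)
  obtain C6 where C6: "C6 \<ge> 0" "\<And>lam f. lam > 0 \<Longrightarrow> in_Lp 2 lborel f \<Longrightarrow>
      in_Lp 6 lborel (osc_op \<psi> lam f) \<and>
      Lp_norm 6 lborel (osc_op \<psi> lam f) \<le> C6 * lam powr (- (1/4)) * Lp_norm 2 lborel f"
    by (rule osc_op_L6_estimate[OF \<psi>]) (rule that)
  have N: "0 \<le> Lp_norm 2 lborel f" for f :: "real \<Rightarrow> complex" by (simp add: Lp_norm_def)
  have mono: "a * b * Lp_norm 2 lborel f \<le> max C2 C6 * b * Lp_norm 2 lborel f"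
    if "a \<le> max C2 C6" "0 \<le> b" for a b and f :: "real \<Rightarrow> complex"
    using that N by (intro mult_right_mono) auto
  show "\<exists>C. \<forall>lam>0. \<forall>f. in_Lp 2 lborel f \<longrightarrow>
              (in_Lp 2 lborel (osc_op \<psi> lam f) \<and>
               Lp_norm 2 lborel (osc_op \<psi> lam f) \<le> C * lam powr (-3/8) * Lp_norm 2 lborel f) \<and>
              (in_Lp 6 lborel (osc_op \<psi> lam f) \<and>
               Lp_norm 6 lborel (osc_op \<psi> lam f) \<le> C * lam powr (-1/4) * Lp_norm 2 lborel f)"
  proof (intro exI[of _ "max C2 C6"] allI impI)
    fix lam :: real and f :: "real \<Rightarrow> complex" assume "lam > 0" "in_Lp 2 lborel f"
    from C2(2)[OF this] C6(2)[OF this]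
    show "(in_Lp 2 lborel (osc_op \<psi> lam f) \<and>
               Lp_norm 2 lborel (osc_op \<psi> lam f) \<le> max C2 C6 * lam powr (-3/8) * Lp_norm 2 lborel f) \<and>
              (in_Lp 6 lborel (osc_op \<psi> lam f) \<and>
               Lp_norm 6 lborel (osc_op \<psi> lam f) \<le> max C2 C6 * lam powr (-1/4) * Lp_norm 2 lborel f)"
      using mono[of C2 "lam powr (-3/8)" f] mono[of C6 "lam powr (-1/4)" f] by auto
  qed
next
  fix \<delta> :: real
  assume "\<forall>\<psi> :: real \<times> real \<times> real \<Rightarrow> complex. Cc_inf \<psi> \<longrightarrow>
              (\<exists>C lam\<^sub>0. \<forall>lam\<ge>lam\<^sub>0. \<forall>f. in_Lp 2 lborel f \<longrightarrow>
                 in_Lp 6 lborel (osc_op \<psi> lam f) \<and>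
                 Lp_norm 6 lborel (osc_op \<psi> lam f) \<le> C * lam powr (-\<delta>) * Lp_norm 2 lborel f)"
  then obtain C lam\<^sub>0 where C: "\<And>lam f. lam \<ge> lam\<^sub>0 \<Longrightarrow> in_Lp 2 lborel f \<Longrightarrow>
                 in_Lp 6 lborel (osc_op bump lam f) \<and>
                 Lp_norm 6 lborel (osc_op bump lam f) \<le> C * lam powr (-\<delta>) * Lp_norm 2 lborel f"
    using Cc_inf_bump by blast
  define N where "N = Lp_norm 2 lborel (indicator {0..1/2} :: real \<Rightarrow> complex)"
  \<comment> \<open>The test function is independent of \<open>lam\<close>, so its norm
    \<open>N\<close> is absorbed into the constant; the two thresholds are merged by a
    maximum.\<close>
  have "exp (-2) / 4 * lam powr (-1/4) \<le> (C * N) * lam powr (-\<delta>)" if "lam \<ge> max lam\<^sub>0 8" for lam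
  proof -
    have l: "lam \<ge> lam\<^sub>0" "lam \<ge> 8" using that by auto
    from C[OF l(1) in_Lp_indicator_half] osc_op_bump_L6_lower_bound[OF l(2)]
    show ?thesis unfolding N_def by (simp only: mult_ac) (meson order_trans)
  qed
  then show "\<delta> \<le> 1/4" by (intro decay_exponent_le[of "exp (-2) / 4" "max lam\<^sub>0 8" "C * N"]) auto
qed

end
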